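(* Let $\nu,\lambda,\gamma,l>0$ and consider the two-layer backward-forward system (described in the context) associated with the uncontrolled Burgers-type equation $y_t=\nu y_{xx}+\lambda y-\gamma yy_x$ on $(0,l)$ with Dirichlet boundary conditions, with $\mathcal H^{\mathfrak c}=\mathrm{span}\{e_1,e_2\}$. Write $\beta_n=\beta_n(\lambda)$. Assume the non-resonance conditions $$\beta_1+\beta_2-\beta_3>0,\quad \beta_1+2\beta_2-\beta_3>0,\quad 3\beta_1-\beta_3>0,\quad 3\beta_1+\beta_2-\beta_3>0,$$ $$2\beta_1+\beta_2-\beta_4>0,\quad 4\beta_1-\beta_4>0,\quad 2\beta_2-\beta_4>0 .$$ Then for every $\xi\in\mathcal H^{\mathfrak c}$ the pullback limit of the solution component $y^{(2)}_{\mathfrak s}[\xi]$ exists and is given by $$h^{(2)}_\lambda(\xi):=\lim_{\tau\to+\infty}y^{(2)}_{\mathfrak s}[\xi](-\tau,0)=\int_{-\infty}^0e^{-\tau'L^{\mathfrak s}_\lambda}P_{\mathfrak s}B\bigl(y^{(2)}_{\mathfrak c}(\tau'),y^{(2)}_{\mathfrak c}(\tau')\bigr)\,d\tau' .$$ Furthermore, for all $(\xi_1,\xi_2)\in\mathbb R^2$, $$h^{(2)}_\lambda(\xi_1e_1+\xi_2e_2)=h^{(2),3}_\lambda(\xi_1,\xi_2)\,e_3+h^{(2),4}_\lambda(\xi_1,\xi_2)\,e_4,$$ where $$h^{(2),3}_\lambda(\xi_1,\xi_2)=\mathbf A\,\xi_1\xi_2+\mathbf B\,\xi_1^3+\mathbf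 C\,\xi_1\xi_2^2+\mathbf D\,\xi_1^3\xi_2,\qquad h^{(2),4}_\lambda(\xi_1,\xi_2)=\mathbf E\,\xi_2^2+\mathbf F\,\xi_1^2\xi_2+\mathbf G\,\xi_1^4,$$ with $\alpha=\frac{\gamma\pi}{\sqrt2\,l^{3/2}}$ and $$\mathbf A=-\frac{3\alpha}{\beta_1+\beta_2-\beta_3},\qquad \mathbf B=-\frac{3\alpha^2}{(3\beta_1-\beta_3)(\beta_1+\beta_2-\beta_3)},\qquad \mathbf C=\frac{3\alpha^2}{(\beta_1+2\beta_2-\beta_3)(\beta_1+\beta_2-\beta_3)},$$ $$\mathbf D=\frac{3\alpha^3}{(3\beta_1-\beta_3)(\beta_1+\beta_2-\beta_3)(\beta_1+2\beta_2-\beta_3)}+\frac{3\alpha^3}{(3\beta_1-\beta_3)(3\beta_1+\beta_2-\beta_3)(\beta_1+2\beta_2-\beta_3)},$$ $$\mathbf E=-\frac{2\alpha}{2\beta_2-\beta_4},\qquad \mathbf F=-\frac{4\alpha^2}{(2\beta_1+\beta_2-\beta_4)(2\beta_2-\beta_4)},\qquad \mathbf G=-\frac{4\alpha^3}{(4\beta_1-\beta_4)(2\beta_1+\beta_2-\beta_4)(2\beta_2-\beta_4)} .$$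
   Context: $\mathcal H=L^2(0,l)$, $L_\lambda y=\nu\,\partial_{xx}y+\lambda y$ with domain $H^2(0,l)\cap H^1_0(0,l)$, with eigenvalues $\beta_n(\lambda)=\lambda-\nu n^2\pi^2/l^2$ and normalized eigenvectors $e_n(x)=\sqrt{2/l}\,\sin(n\pi x/l)$, $n\ge1$. The bilinear map is $B(u,v)=-\gamma\,u\,\partial_xv$ on $H^1_0(0,l)\times H_0^1(0,l)$. $\mathcal H^{\mathfrak c}=\mathrm{span}\{e_1,e_2\}$, $\mathcal H^{\mathfrak s}$ is its orthogonal complement in $\mathcal H$, $P_{\mathfrak c},P_{\mathfrak s}$ the corresponding projectors, $L^{\mathfrak c}_\lambda=P_{\mathfrak c}L_\lambda$, $L^{\mathfrak s}_\lambda=P_{\mathfrak s}L_\lambda$. Two-layer backward-forward system: for $\tau>0$ and $\xi\in\mathcal H^{\mathfrak c}$, on $s\in[-\tau,0]$, $$\frac{dy^{(1)}_{\mathfrak c}}{ds}=L^{\mathfrak c}_\lambda y^{(1)}_{\mathfrak c},\quad y^{(1)}_{\mathfrak c}(0)=\xi;\qquad \frac{dy^{(2)}_{\mathfrak c}}{ds}=L^{\mathfrak c}_\lambda y^{(2)}_{\mathfrak c}+P_{\mathfrak c}B(y^{(1)}_{\mathfrak c},y^{(1)}_{\mathfrak c}),\quad y^{(2)}_{\mathfrak c}(0)=\xi;$$ $$\frac{dy^{(2)}_{\mathfrak s}}{ds}=L^{\mathfrak s}_\lambda y^{(2)}_{\mathfrak s}+P_{\mathfrak s}B(y^{(2)}_{\mathfrak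 c},y^{(2)}_{\mathfrak c}),\quad y^{(2)}_{\mathfrak s}(-\tau)=0 .$$ The first two equations are integrated backward from $s=0$, and then the third forward from $s=-\tau$. $y^{(2)}_{\mathfrak s}[\xi](-\tau,s)$ denotes the value at $s$ of the third component, started from $0$ at time $-\tau$. *)

theory Defs
  imports "HOL-Analysis.Analysis"
begin

section \<open>The real Hilbert space of square-integrable functions on the line\<close>

definition square_int :: "(real \<Rightarrow> real) \<Rightarrow> bool" where
  "square_int f \<longleftrightarrow> f \<in> borel_measurable lborel \<and> integrable lborel (\<lambda>x. (f x)\<^sup>2)"

lemma square_int_zero [simp]: "square_int (\<lambda>x. 0)"
  by (simp add: square_int_def)

lemma square_int_mult:
  assumes "square_int f" "square_int g"
  shows "integrable lborel (\<lambda>x. f x * g x)"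
proof (rule Bochner_Integration.integrable_bound)
  show "integrable lborel (\<lambda>x. (f x)\<^sup>2 + (g x)\<^sup>2)"
    using assms by (auto simp: square_int_def)
  show "(\<lambda>x. f x * g x) \<in> borel_measurable lborel"
    using assms by (auto simp: square_int_def)
  have "\<bar>a * b\<bar> \<le> a\<^sup>2 + b\<^sup>2" for a b :: real
  proof -
    have "0 \<le> (\<bar>a\<bar> - \<bar>b\<bar>)\<^sup>2 + (a\<^sup>2 + b\<^sup>2)" by simp
    then show ?thesis by (simp add: power2_diff abs_mult)
  qed
  then show "AE x in lborel. norm (f x * g x) \<le> norm ((f x)\<^sup>2 + (g x)\<^sup>2)"
    by auto
qed

lemma square_int_add:
  assumes "square_int f" "square_int g"
  shows "square_int (\<lambda>x. f x + g x)"
proof -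
  have "integrable lborel (\<lambda>x. (f x)\<^sup>2 + (g x)\<^sup>2 + 2 * (f x * g x))"
    using assms square_int_mult[OF assms] unfolding square_int_def
    by (intro Bochner_Integration.integrable_add integrable_mult_right) auto
  then show ?thesis
    using assms by (auto simp: square_int_def power2_sum mult.assoc intro: borel_measurable_add)
qed

lemma square_int_scale:
  "square_int f \<Longrightarrow> square_int (\<lambda>x. c * f x)"
  by (auto simp: square_int_def power_mult_distrib)

quotient_type ltwo = "real \<Rightarrow> real" / partial:
  "\<lambda>f g. square_int f \<and> square_int g \<and> (AE x in lborel. f x = g x)"
proof (rule part_equivpI)
  show "\<exists>f. square_int f \<and> square_int f \<and> (AE x in lborel. f x = f x)"
    by (rule exI[of _ "\<lambda>x. 0"]) simp
  show "symp (\<lambda>f g. square_int f \<and> square_int g \<and> (AE x in lborel. f x = g x))"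
    by (auto intro!: sympI elim: AE_mp)
  show "transp (\<lambda>f g. square_int f \<and> square_int g \<and> (AE x in lborel. f x = g x))"
    by (auto intro!: transpI elim: AE_mp)
qed

lemma ltwo_rep:
  shows square_int_rep: "square_int (rep_ltwo u)"
    and abs_rep_ltwo: "abs_ltwo (rep_ltwo u) = u"
  using Quotient3_rep_reflp[OF Quotient3_ltwo, of u] Quotient3_abs_rep[OF Quotient3_ltwo, of u]
  by auto

lemma rep_abs_ltwo:
  assumes "square_int f"
  shows "AE x in lborel. rep_ltwo (abs_ltwo f) x = f x"
  using rep_abs_rsp_left[OF Quotient3_ltwo, of f f] assms by auto

lemma integral_cong_prod_AE:
  fixes f f' g g' :: "real \<Rightarrow> real"
  assumes "square_int f" "square_int f'" "square_int g" "square_int g'"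
    and "AE x in lborel. f x = f' x" "AE x in lborel. g x = g' x"
  shows "(LINT x|lborel. f x * g x) = (LINT x|lborel. f' x * g' x)"
proof (rule integral_cong_AE)
  show "(\<lambda>x. f x * g x) \<in> borel_measurable lborel" "(\<lambda>x. f' x * g' x) \<in> borel_measurable lborel"
    using assms by (auto simp: square_int_def)
  show "AE x in lborel. f x * g x = f' x * g' x"
    using assms(5,6) by eventually_elim simp
qed

instantiation ltwo :: real_vector
begin

lift_definition zero_ltwo :: ltwo is "\<lambda>x. 0" by simp

lift_definition plus_ltwo :: "ltwo \<Rightarrow> ltwo \<Rightarrow> ltwo" is "\<lambda>f g x. f x + g x"
  by (auto intro: square_int_add)

lift_definition scaleR_ltwo :: "real \<Rightarrow> ltwo \<Rightarrow> ltwo" is "\<lambda>c f x. c * f x"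
  by (auto intro: square_int_scale)

definition uminus_ltwo :: "ltwo \<Rightarrow> ltwo" where "uminus_ltwo u = (-1) *\<^sub>R u"

definition minus_ltwo :: "ltwo \<Rightarrow> ltwo \<Rightarrow> ltwo" where "minus_ltwo u v = u + (- v)"

instance
proof
  fix u v w :: ltwo and a b :: real
  show "u + v + w = u + (v + w)"
    by transfer (auto simp: add.assoc intro!: square_int_add)
  show "u + v = v + u"
    by transfer (auto simp: add.commute intro!: square_int_add)
  show "0 + u = u" by transfer auto
  show "- u + u = 0" unfolding uminus_ltwo_def
    by transfer (auto intro!: square_int_add square_int_scale[of _ "-1", simplified])
  show "u - v = u + - v" by (simp add: minus_ltwo_def)
  show "a *\<^sub>R (u + v) = a *\<^sub>R u + a *\<^sub>R v"
    by transfer (auto simp: distrib_left intro!: square_int_add square_int_scale)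
  show "(a + b) *\<^sub>R u = a *\<^sub>R u + b *\<^sub>R u"
    by transfer (auto simp: distrib_right intro!: square_int_add square_int_scale)
  show "a *\<^sub>R b *\<^sub>R u = (a * b) *\<^sub>R u"
    by transfer (auto simp: mult.assoc intro!: square_int_scale)
  show "1 *\<^sub>R u = u" by transfer auto
qed

end

instantiation ltwo :: real_inner
begin

lift_definition inner_ltwo :: "ltwo \<Rightarrow> ltwo \<Rightarrow> real" is "\<lambda>f g. LINT x|lborel. f x * g x"
  by (auto intro: integral_cong_prod_AE)

definition norm_ltwo :: "ltwo \<Rightarrow> real" where "norm_ltwo u = sqrt (inner u u)"

definition dist_ltwo :: "ltwo \<Rightarrow> ltwo \<Rightarrow> real" where "dist_ltwo u v = norm (u - v)"

definition sgn_ltwo :: "ltwo \<Rightarrow> ltwo" where "sgn_ltwo u = inverse (norm u) *\<^sub>R u"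

definition uniformity_ltwo :: "(ltwo \<times> ltwo) filter" where
  "uniformity_ltwo = (INF e\<in>{0<..}. principal {(u, v). dist u v < e})"

definition open_ltwo :: "ltwo set \<Rightarrow> bool" where
  "open_ltwo U \<longleftrightarrow> (\<forall>u\<in>U. eventually (\<lambda>(u', v). u' = u \<longrightarrow> v \<in> U) uniformity)"

instance
proof
  fix u v w :: ltwo and a :: real and U :: "ltwo set"
  show "dist u v = norm (u - v)" by (simp add: dist_ltwo_def)
  show "sgn u = inverse (norm u) *\<^sub>R u" by (simp add: sgn_ltwo_def)
  show "uniformity = (INF e\<in>{0<..}. principal {(u, v :: ltwo). dist u v < e})"
    by (simp add: uniformity_ltwo_def)
  show "open U \<longleftrightarrow> (\<forall>u\<in>U. eventually (\<lambda>(u', v). u' = u \<longrightarrow> v \<in> U) uniformity)"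
    by (simp add: open_ltwo_def)
  show "inner u v = inner v u"
    by transfer (simp add: mult.commute)
  show "inner (u + v) w = inner u w + inner v w"
    by transfer (simp add: distrib_right square_int_mult)
  show "inner (a *\<^sub>R u) v = a * inner u v"
    by transfer (simp add: mult.assoc)
  show "0 \<le> inner u u" by transfer simp
  show "inner u u = 0 \<longleftrightarrow> u = 0"
  proof transfer
    fix f :: "real \<Rightarrow> real"
    assume "square_int f \<and> square_int f \<and> (AE x in lborel. f x = f x)"
    then have f: "square_int f" by simp
    then have "(LINT x|lborel. f x * f x) = 0 \<longleftrightarrow> (AE x in lborel. f x * f x = 0)"
      by (intro integral_nonneg_eq_0_iff_AE square_int_mult) auto
    then show "((LINT x|lborel. f x * f x) = 0) =
        (square_int f \<and> square_int (\<lambda>x. 0) \<and> (AE x in lborel. f x = 0))"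
      using f by simp
  qed
  show "norm u = sqrt (inner u u)" by (simp add: norm_ltwo_def)
qed

end

section \<open>Function spaces on a bounded interval\<close>

text \<open>$L^2(0,l)$ is identified with the closed subspace of $L^2$ of the line consisting of
  the classes that vanish almost everywhere outside $(0,l)$.\<close>

definition L2_on :: "real \<Rightarrow> ltwo set" where
  "L2_on l = {u. AE x in lborel. x \<notin> {0<..<l} \<longrightarrow> rep_ltwo u x = 0}"

text \<open>Sobolev spaces as in Brezis' textbook (Chapter 8): in dimension one, weak derivatives
  are tested against, and $H^1_0$ is the closure of, the compactly supported
  functions of class $C^1$ (equivalently $C^\infty$) on $(0,l)$.\<close>

definition C1c :: "real \<Rightarrow> (real \<Rightarrow> real) \<Rightarrow> bool" where
  "C1c l \<phi> \<longleftrightarrow> \<phi> C1_differentiable_on UNIV \<and>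
     (\<exists>a b. 0 < a \<and> b < l \<and> (\<forall>x. x \<notin> {a..b} \<longrightarrow> \<phi> x = 0))"

definition has_weak_deriv :: "real \<Rightarrow> ltwo \<Rightarrow> ltwo \<Rightarrow> bool" where
  "has_weak_deriv l u v \<longleftrightarrow>
     (\<forall>\<phi>. C1c l \<phi> \<longrightarrow> inner u (abs_ltwo (deriv \<phi>)) = - inner v (abs_ltwo \<phi>))"

definition H1 :: "real \<Rightarrow> ltwo set" where
  "H1 l = {u \<in> L2_on l. \<exists>v \<in> L2_on l. has_weak_deriv l u v}"

definition wderiv :: "real \<Rightarrow> ltwo \<Rightarrow> ltwo" where
  "wderiv l u = (THE v. v \<in> L2_on l \<and> has_weak_deriv l u v)"

definition H1_norm :: "real \<Rightarrow> ltwo \<Rightarrow> real" where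
  "H1_norm l u = sqrt ((norm u)\<^sup>2 + (norm (wderiv l u))\<^sup>2)"

definition H10 :: "real \<Rightarrow> ltwo set" where
  "H10 l = {u \<in> H1 l. \<exists>\<phi> :: nat \<Rightarrow> real \<Rightarrow> real. (\<forall>k. C1c l (\<phi> k)) \<and>
      (\<lambda>k. H1_norm l (u - abs_ltwo (\<phi> k))) \<longlonglongrightarrow> 0}"

definition H2 :: "real \<Rightarrow> ltwo set" where
  "H2 l = {u \<in> H1 l. wderiv l u \<in> H1 l}"

section \<open>The operators of the Burgers-type equation\<close>

definition Ldom :: "real \<Rightarrow> ltwo set" where
  "Ldom l = H2 l \<inter> H10 l"

definition Lop :: "real \<Rightarrow> real \<Rightarrow> real \<Rightarrow> ltwo \<Rightarrow> ltwo" where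
  "Lop \<nu> lam l y = \<nu> *\<^sub>R wderiv l (wderiv l y) + lam *\<^sub>R y"

definition eigval :: "real \<Rightarrow> real \<Rightarrow> real \<Rightarrow> nat \<Rightarrow> real" where
  "eigval \<nu> lam l n = lam - \<nu> * (real n)\<^sup>2 * pi\<^sup>2 / l\<^sup>2"

definition eigvec :: "real \<Rightarrow> nat \<Rightarrow> ltwo" where
  "eigvec l n = abs_ltwo (\<lambda>x. indicator {0<..<l} x * (sqrt (2 / l) * sin (real n * pi * x / l)))"

text \<open>Only used for arguments in \<open>H10 l\<close>, where the product is square integrable because
  elements of \<open>H10 l\<close> are bounded.\<close>

definition Bop :: "real \<Rightarrow> real \<Rightarrow> ltwo \<Rightarrow> ltwo \<Rightarrow> ltwo" where
  "Bop \<gamma> l u v = abs_ltwo (\<lambda>x. - \<gamma> * rep_ltwo u x * rep_ltwo (wderiv l v) x)"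

definition Hc :: "real \<Rightarrow> ltwo set" where
  "Hc l = span {eigvec l 1, eigvec l 2}"

definition Hs :: "real \<Rightarrow> ltwo set" where
  "Hs l = {u \<in> L2_on l. \<forall>v \<in> Hc l. orthogonal u v}"

definition orth_proj :: "ltwo set \<Rightarrow> ltwo \<Rightarrow> ltwo" where
  "orth_proj V u = (THE p. p \<in> V \<and> (\<forall>v\<in>V. orthogonal (u - p) v))"

abbreviation Pc :: "real \<Rightarrow> ltwo \<Rightarrow> ltwo" where "Pc l \<equiv> orth_proj (Hc l)"

abbreviation Ps :: "real \<Rightarrow> ltwo \<Rightarrow> ltwo" where "Ps l \<equiv> orth_proj (Hs l)"

definition Lc :: "real \<Rightarrow> real \<Rightarrow> real \<Rightarrow> ltwo \<Rightarrow> ltwo" where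
  "Lc \<nu> lam l y = Pc l (Lop \<nu> lam l y)"

definition Ls :: "real \<Rightarrow> real \<Rightarrow> real \<Rightarrow> ltwo \<Rightarrow> ltwo" where
  "Ls \<nu> lam l y = Ps l (Lop \<nu> lam l y)"

text \<open>The semigroup $e^{tA}$ of an operator \<open>A\<close> with domain \<open>D\<close>, as the solution operator of
  the abstract Cauchy problem $u' = Au$, $u(0) = x$ (classical solutions on
  $(0,\infty)$, continuous up to $t = 0$).\<close>

definition semigroup_op ::
    "'a::real_normed_vector set \<Rightarrow> ('a \<Rightarrow> 'a) \<Rightarrow> real \<Rightarrow> 'a \<Rightarrow> 'a" where
  "semigroup_op D A t x = (THE v. \<exists>u. u 0 = x \<and> continuous_on {0..} u \<and>
      (\<forall>s>0. u s \<in> D \<and> (u has_vector_derivative A (u s)) (at s)) \<and> v = u t)"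

definition exp_Ls :: "real \<Rightarrow> real \<Rightarrow> real \<Rightarrow> real \<Rightarrow> ltwo \<Rightarrow> ltwo" where
  "exp_Ls \<nu> lam l t = semigroup_op (Ldom l \<inter> Hs l) (Ls \<nu> lam l) t"

section \<open>The two-layer backward-forward system\<close>

text \<open>The two backward equations, on a time interval \<open>I\<close> with right end point 0.\<close>

definition backward_layers ::
    "real \<Rightarrow> real \<Rightarrow> real \<Rightarrow> real \<Rightarrow> ltwo \<Rightarrow> real set \<Rightarrow> (real \<Rightarrow> ltwo) \<Rightarrow> (real \<Rightarrow> ltwo) \<Rightarrow> bool" where
  "backward_layers \<nu> lam \<gamma> l \<xi> I y1 y2 \<longleftrightarrow>
     y1 0 = \<xi> \<and> y2 0 = \<xi> \<and>
     (\<forall>s\<in>I. y1 s \<in> Hc l \<and> (y1 has_vector_derivative Lc \<nu> lam l (y1 s)) (at s within I)) \<and>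
     (\<forall>s\<in>I. y2 s \<in> Hc l \<and>
        (y2 has_vector_derivative Lc \<nu> lam l (y2 s) + Pc l (Bop \<gamma> l (y1 s) (y1 s))) (at s within I))"

definition two_layer_system ::
    "real \<Rightarrow> real \<Rightarrow> real \<Rightarrow> real \<Rightarrow> real \<Rightarrow> ltwo \<Rightarrow>
     (real \<Rightarrow> ltwo) \<Rightarrow> (real \<Rightarrow> ltwo) \<Rightarrow> (real \<Rightarrow> ltwo) \<Rightarrow> bool" where
  "two_layer_system \<nu> lam \<gamma> l \<tau> \<xi> y1 y2 ys \<longleftrightarrow>
     backward_layers \<nu> lam \<gamma> l \<xi> {-\<tau>..0} y1 y2 \<and>
     ys (-\<tau>) = 0 \<and>
     (\<forall>s\<in>{-\<tau>..0}. ys s \<in> Ldom l \<inter> Hs l \<and>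
        (ys has_vector_derivative Ls \<nu> lam l (ys s) + Ps l (Bop \<gamma> l (y2 s) (y2 s)))
          (at s within {-\<tau>..0}))"

text \<open>Solutions are unique only on their time interval, so the definite descriptions pick out
  the value at a given time rather than the trajectory.\<close>

definition yc2 :: "real \<Rightarrow> real \<Rightarrow> real \<Rightarrow> real \<Rightarrow> ltwo \<Rightarrow> real \<Rightarrow> ltwo" where
  "yc2 \<nu> lam \<gamma> l \<xi> s =
     (THE v. \<exists>y1 y2. backward_layers \<nu> lam \<gamma> l \<xi> {..0} y1 y2 \<and> v = y2 s)"

text \<open>$y^{(2)}_{\mathfrak s}[\xi](-\tau,s)$\<close>

definition ys2 :: "real \<Rightarrow> real \<Rightarrow> real \<Rightarrow> real \<Rightarrow> ltwo \<Rightarrow> real \<Rightarrow> real \<Rightarrow> ltwo" where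
  "ys2 \<nu> lam \<gamma> l \<xi> \<tau> s =
     (THE v. \<exists>y1 y2 ys. two_layer_system \<nu> lam \<gamma> l \<tau> \<xi> y1 y2 ys \<and> v = ys s)"

definition pullback_h2 :: "real \<Rightarrow> real \<Rightarrow> real \<Rightarrow> real \<Rightarrow> ltwo \<Rightarrow> ltwo" where
  "pullback_h2 \<nu> lam \<gamma> l \<xi> = Lim at_top (\<lambda>\<tau>. ys2 \<nu> lam \<gamma> l \<xi> \<tau> 0)"

text \<open>Values in the Hilbert space are integrated over $(-\infty,0]$ with the Henstock-Kurzweil
  integral; together with integrability of the norm this is the Bochner integral.\<close>

definition pullback_integrand ::
    "real \<Rightarrow> real \<Rightarrow> real \<Rightarrow> real \<Rightarrow> ltwo \<Rightarrow> real \<Rightarrow> ltwo" where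
  "pullback_integrand \<nu> lam \<gamma> l \<xi> t =
     exp_Ls \<nu> lam l (- t) (Ps l (Bop \<gamma> l (yc2 \<nu> lam \<gamma> l \<xi> t) (yc2 \<nu> lam \<gamma> l \<xi> t)))"

end

theory Submission
  imports Defs
begin

text \<open>
  Both backward equations live on the plane spanned by \<open>e1\<close>, \<open>e2\<close>. The quadratic term sends
  $a e_1 + b e_2$ to $\alpha a b\, e_1 - \alpha a^2 e_2 - 3 \alpha a b\, e_3 - 2 \alpha b^2 e_4$, so the whole
  system is triangular and can be solved explicitly, and the stable component stays in the span of
  \<open>e3\<close>, \<open>e4\<close>. After multiplication by $e^{-\beta_3 s}$ and $e^{-\beta_4 s}$ the forcing terms are
  combinations of decaying exponentials (with a factor $\int_0^s e^{\beta_2 t}\,dt$, which also covers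
  $\beta_2 = 0$), whose primitives vanish at $-\infty$ and equal the asserted polynomials at $0$.

  That these explicit solutions are the only ones follows from energy estimates. For the stable
  equation one needs $\langle y'', y\rangle = -\|y'\|^2$ on $H^2 \cap H^1_0$, which is the definition of
  the weak derivative tested against functions converging to \<open>y\<close> in $H^1$. Cutoffs
  $\psi / (\varepsilon + \psi)$ give the uniqueness of weak derivatives and place the sine functions
  in $H^1_0$.
\<close>

section \<open>Square-integrable functions on an interval\<close>

text \<open>The objects of the statement (\<open>wderiv\<close>, \<open>orth_proj\<close>,
  \<open>semigroup_op\<close>, \<open>yc2\<close>, \<open>ys2\<close>) are definite descriptions, so
  an explicit candidate is worth nothing without a uniqueness statement. The two uniqueness proofs
  differ. The backward equations live in a plane, where time can be reversed and any bound on the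
  two eigenvalues will do. A competitor for the stable component is only known to lie in
  \<open>Ldom l\<close> and \<open>Hs l\<close>, where the operator is unbounded; but this equation
  runs forward, so a one-sided bound of the quadratic form by \<open>lam\<close> suffices. For the
  sines to lie in \<open>H10 l\<close> the obstacle is the derivative of the cutoffs, which blows up
  near the end points; the linear vanishing of the sines there compensates for it. The last obstacle
  is algebraic. The second layer carries the denominator 2 \<beta>1 - \<beta>2, which is absent from
  the asserted coefficients. It cancels because the rates of the exponentials that meet in one
  component differ by multiples of this number, so that differences of their reciprocals contain it
  as a factor.\<close>

definition restr :: "real \<Rightarrow> (real \<Rightarrow> real) \<Rightarrow> ltwo" where
  "restr l f = abs_ltwo (\<lambda>x. indicator {0<..<l} x * f x)"

lemma abs_ltwo_cong:
  assumes "square_int f" "square_int g" "AE x in lborel. f x = g x"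
  shows "abs_ltwo f = abs_ltwo g"
  using Quotient3_rel_abs[OF Quotient3_ltwo] assms by blast

text \<open>\<open>abs_ltwo\<close> is meaningful only on square integrable functions. Continuity on
  the compact interval supplies this for \<open>restr l f\<close>, whatever f does outside.\<close>

lemma square_int_indicator:
  fixes f :: "real \<Rightarrow> real"
  assumes "continuous_on UNIV f"
  shows "square_int (\<lambda>x. indicator {0<..<l} x * f x)"
proof -
  have m: "f \<in> borel_measurable borel"
    using assms by (simp add: borel_measurable_continuous_onI)
  have "continuous_on {0..l} (\<lambda>x. (f x)\<^sup>2)"
    using assms by (intro continuous_intros) (auto intro: continuous_on_subset)
  then have "integrable lborel (\<lambda>x. indicator {0..l} x *\<^sub>R (f x)\<^sup>2)"
    using borel_integrable_atLeastAtMost' unfolding set_integrable_def by blast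
  then have "integrable lborel (\<lambda>x. (indicator {0<..<l} x * f x)\<^sup>2)"
    by (rule Bochner_Integration.integrable_bound) (use m in \<open>auto simp: indicator_def\<close>)
  then show ?thesis
    using m by (auto simp: square_int_def)
qed

lemma inner_abs_ltwo:
  assumes "square_int f" "square_int g"
  shows "inner (abs_ltwo f) (abs_ltwo g) = (LINT x|lborel. f x * g x)"
  using assms by (intro inner_ltwo.abs_eq) (auto simp: eq_onp_def)

lemma restr_add:
  assumes "continuous_on UNIV f" "continuous_on UNIV g"
  shows "restr l f + restr l g = restr l (\<lambda>x. f x + g x)"
proof -
  have "restr l f + restr l g = abs_ltwo (\<lambda>x. indicator {0<..<l} x * f x + indicator {0<..<l} x * g x)"
    unfolding restr_def using assms
    by (intro plus_ltwo.abs_eq) (auto simp: eq_onp_def square_int_indicator)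
  then show ?thesis by (simp add: restr_def distrib_left)
qed

lemma restr_scale:
  assumes "continuous_on UNIV f"
  shows "c *\<^sub>R restr l f = restr l (\<lambda>x. c * f x)"
proof -
  have "c *\<^sub>R restr l f = abs_ltwo (\<lambda>x. c * (indicator {0<..<l} x * f x))"
    unfolding restr_def using assms
    by (intro scaleR_ltwo.abs_eq) (auto simp: eq_onp_def square_int_indicator)
  then show ?thesis by (simp add: restr_def algebra_simps)
qed

lemma rep_restr:
  "continuous_on UNIV f \<Longrightarrow> AE x in lborel. rep_ltwo (restr l f) x = indicator {0<..<l} x * f x"
  unfolding restr_def by (intro rep_abs_ltwo square_int_indicator)

text \<open>Moves inner products from the quotient to integrals of continuous functions over a
  closed interval, where the fundamental theorem of calculus applies; the end points form a null
  set.\<close>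

lemma inner_restr:
  assumes "continuous_on UNIV f" "continuous_on UNIV g"
  shows "inner (restr l f) (restr l g) = integral {0..l} (\<lambda>x. f x * g x)"
proof -
  have "continuous_on {0..l} (\<lambda>x. f x * g x)"
    using assms by (intro continuous_intros) (auto intro: continuous_on_subset)
  then have i: "set_integrable lborel {0..l} (\<lambda>x. f x * g x)"
    by (rule borel_integrable_atLeastAtMost')
  then have i': "set_integrable lborel {0<..<l} (\<lambda>x. f x * g x)"
    by (rule set_integrable_subset) auto
  have "inner (restr l f) (restr l g) = (LINT x:{0<..<l}|lborel. f x * g x)"
    unfolding restr_def inner_abs_ltwo[OF square_int_indicator[OF assms(1)] square_int_indicator[OF assms(2)]]
      set_lebesgue_integral_def
    by (rule Bochner_Integration.integral_cong) (auto simp: indicator_def)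
  also have "\<dots> = integral {0<..<l} (\<lambda>x. f x * g x)"
    using i' by (rule set_borel_integral_eq_integral)
  also have "\<dots> = integral {0..l} (\<lambda>x. f x * g x)"
    by (simp add: integral_open_interval_real)
  finally show ?thesis .
qed

lemma L2_on_AE: "u \<in> L2_on l \<longleftrightarrow> (AE x in lborel. rep_ltwo u x = indicator {0<..<l} x * rep_ltwo u x)"
  unfolding L2_on_def by (auto simp: indicator_def elim!: eventually_mono)

lemma restr_in_L2_on: "continuous_on UNIV f \<Longrightarrow> restr l f \<in> L2_on l"
  unfolding L2_on_def using rep_restr[of f l] by (auto elim!: eventually_mono)

text \<open>\<open>rep_ltwo\<close> is an arbitrary choice of representative, so it respects the
  vector operations only almost everywhere.\<close>

lemma rep_plus: "AE x in lborel. rep_ltwo (u + v) x = rep_ltwo u x + rep_ltwo v x"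
proof -
  have "u + v = abs_ltwo (\<lambda>x. rep_ltwo u x + rep_ltwo v x)"
    using plus_ltwo.abs_eq[of "rep_ltwo u" "rep_ltwo v"] by (simp add: abs_rep_ltwo eq_onp_def square_int_rep)
  then show ?thesis
    using rep_abs_ltwo[OF square_int_add[OF square_int_rep[of u] square_int_rep[of v]]] by simp
qed

lemma rep_scaleR: "AE x in lborel. rep_ltwo (c *\<^sub>R u) x = c * rep_ltwo u x"
proof -
  have "c *\<^sub>R u = abs_ltwo (\<lambda>x. c * rep_ltwo u x)"
    using scaleR_ltwo.abs_eq[of "rep_ltwo u" c] by (simp add: abs_rep_ltwo eq_onp_def square_int_rep)
  then show ?thesis
    using rep_abs_ltwo[OF square_int_scale[OF square_int_rep[of u]]] by simp
qed

lemma rep_zero: "AE x in lborel. rep_ltwo 0 x = 0"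
  unfolding zero_ltwo_def by (rule rep_abs_ltwo) simp

lemma subspace_L2_on: "subspace (L2_on l)"
proof (rule subspaceI)
  show "0 \<in> L2_on l"
    using rep_zero unfolding L2_on_def by (auto elim!: eventually_mono)
  fix u v c assume u: "u \<in> L2_on l"
  show "c *\<^sub>R u \<in> L2_on l"
    using u rep_scaleR[of c u] unfolding L2_on_def mem_Collect_eq by eventually_elim auto
  assume v: "v \<in> L2_on l"
  show "u + v \<in> L2_on l"
    using u v rep_plus[of u v] unfolding L2_on_def mem_Collect_eq by eventually_elim auto
qed

section \<open>Cutoff functions\<close>

text \<open>Squaring smooths the corner of the truncation: at 0 the difference quotient is
  \<open>max 0 h\<close>, which tends to 0. The result is of class C^1, the regularity that
  \<open>C1c\<close> asks for.\<close>

lemma DERIV_max0_sq [derivative_intros]: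
  assumes "(f has_real_derivative f') (at x)"
  shows "((\<lambda>x. (max 0 (f x))\<^sup>2) has_real_derivative 2 * max 0 (f x) * f') (at x)"
proof -
  have "((\<lambda>x::real. (max 0 x)\<^sup>2) has_real_derivative 2 * max 0 y) (at y)" for y
  proof (cases "y = 0")
    case False
    show ?thesis
    proof (cases "y > 0")
      case True
      have "((\<lambda>x::real. x\<^sup>2) has_real_derivative 2 * y) (at y)"
        by (auto intro!: derivative_eq_intros)
      then have "((\<lambda>x::real. (max 0 x)\<^sup>2) has_real_derivative 2 * y) (at y)"
        by (rule has_field_derivative_transform_within_open[of _ _ _ "{0<..}"]) (use True in auto)
      then show ?thesis using True by simp
    next
      case False
      with \<open>y \<noteq> 0\<close> have "y < 0" by simp
      have "((\<lambda>x::real. 0) has_real_derivative 0) (at y)"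
        by (auto intro!: derivative_eq_intros)
      then have "((\<lambda>x::real. (max 0 x)\<^sup>2) has_real_derivative 0) (at y)"
        by (rule has_field_derivative_transform_within_open[of _ _ _ "{..<0}"]) (use \<open>y < 0\<close> in auto)
      then show ?thesis using \<open>y < 0\<close> by simp
    qed
  next
    case True
    have "(\<lambda>h. ((max 0 (0 + h))\<^sup>2 - (max 0 0)\<^sup>2) / h) = (\<lambda>h::real. max 0 h)"
      by (auto simp: fun_eq_iff max_def power2_eq_square)
    moreover have "((\<lambda>h::real. max 0 h) \<longlongrightarrow> max 0 0) (at 0)"
      by (intro tendsto_intros)
    ultimately show ?thesis using True by (simp add: DERIV_def)
  qed
  from DERIV_chain2[OF this assms] show ?thesis .
qed

text \<open>The single parameter e has two roles: it pulls the support into the compact interval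
  from a + e to b - e, and it regularizes the denominator. If that interval is empty, the cutoff is
  identically 0.\<close>

definition bump :: "real \<Rightarrow> real \<Rightarrow> real \<Rightarrow> real \<Rightarrow> real" where
  "bump a b e x = (max 0 (x - a - e))\<^sup>2 * (max 0 (b - e - x))\<^sup>2 /
     (e + (max 0 (x - a - e))\<^sup>2 * (max 0 (b - e - x))\<^sup>2)"

text \<open>With \<psi> = p^2 q^2 one has \<psi>' = 2 p q (q - p), and the quotient rule for \<psi>
  / (e + \<psi>) collapses to e \<psi>' / (e + \<psi>)^2.\<close>

definition bump' :: "real \<Rightarrow> real \<Rightarrow> real \<Rightarrow> real \<Rightarrow> real" where
  "bump' a b e x = (let p = max 0 (x - a - e); q = max 0 (b - e - x) in
     2 * (p * q) * (q - p) * e / (e + p\<^sup>2 * q\<^sup>2)\<^sup>2)"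

lemma bump_deriv:
  assumes "e > 0"
  shows "(bump a b e has_real_derivative bump' a b e x) (at x)"
proof -
  define p q where "p = max 0 (x - a - e)" and "q = max 0 (b - e - x)"
  have pos: "e + p\<^sup>2 * q\<^sup>2 > 0" using assms by (simp add: add_pos_nonneg)
  then have nz: "e + p\<^sup>2 * q\<^sup>2 \<noteq> 0" by simp
  have "(bump a b e has_real_derivative
      ((2 * p * q\<^sup>2 + p\<^sup>2 * (- 2 * q)) * (e + p\<^sup>2 * q\<^sup>2) - (p\<^sup>2 * q\<^sup>2) * (2 * p * q\<^sup>2 + p\<^sup>2 * (- 2 * q)))
        / ((e + p\<^sup>2 * q\<^sup>2) * (e + p\<^sup>2 * q\<^sup>2))) (at x)"
    unfolding bump_def using nz unfolding p_def q_def
    by (auto intro!: derivative_eq_intros simp: algebra_simps)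
  moreover have "((2 * p * q\<^sup>2 + p\<^sup>2 * (- 2 * q)) * (e + p\<^sup>2 * q\<^sup>2) - (p\<^sup>2 * q\<^sup>2) * (2 * p * q\<^sup>2 + p\<^sup>2 * (- 2 * q)))
        / ((e + p\<^sup>2 * q\<^sup>2) * (e + p\<^sup>2 * q\<^sup>2)) = bump' a b e x"
    unfolding bump'_def Let_def p_def[symmetric] q_def[symmetric]
    using nz by (simp add: power2_eq_square algebra_simps)
  ultimately show ?thesis by simp
qed

lemma continuous_bump': "e > 0 \<Longrightarrow> continuous_on UNIV (bump' a b e)"
  unfolding bump'_def Let_def
  by (intro continuous_intros) (smt (verit, best) UNIV_I mult_nonneg_nonneg zero_le_power2 power_eq_0_iff)

lemma continuous_bump: "e > 0 \<Longrightarrow> continuous_on UNIV (bump a b e)"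
  by (auto intro!: continuous_at_imp_continuous_on DERIV_isCont[OF bump_deriv])

lemma bump_outside: "x \<notin> {a + e..b - e} \<Longrightarrow> bump a b e x = 0"
  by (auto simp: bump_def)

lemma bump_bounds: "e > 0 \<Longrightarrow> 0 \<le> bump a b e x \<and> bump a b e x \<le> 1"
  unfolding bump_def by (auto simp: divide_simps add_pos_nonneg)

lemma bump_tendsto:
  assumes "a < x" "x < b"
  shows "(\<lambda>k. bump a b (1 / Suc k) x) \<longlonglongrightarrow> 1"
proof -
  have e: "(\<lambda>k. 1 / real (Suc k)) \<longlonglongrightarrow> 0"
    using LIMSEQ_inverse_real_of_nat by (simp add: inverse_eq_divide)
  let ?P = "(max 0 (x - a - 0))\<^sup>2 * (max 0 (b - 0 - x))\<^sup>2"
  have "?P \<noteq> 0" using assms by simp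
  then have "(\<lambda>k. bump a b (1 / Suc k) x) \<longlonglongrightarrow> ?P / (0 + ?P)"
    unfolding bump_def using assms by (intro tendsto_intros e) auto
  then show ?thesis using assms by simp
qed

lemma bump'_tendsto:
  assumes "a < x" "x < b"
  shows "(\<lambda>k. bump' a b (1 / Suc k) x) \<longlonglongrightarrow> 0"
proof -
  have e: "(\<lambda>k. 1 / real (Suc k)) \<longlonglongrightarrow> 0"
    using LIMSEQ_inverse_real_of_nat by (simp add: inverse_eq_divide)
  let ?p = "max 0 (x - a - 0)" let ?q = "max 0 (b - 0 - x)"
  have "(\<lambda>k. bump' a b (1 / Suc k) x) \<longlonglongrightarrow> 2 * (?p * ?q) * (?q - ?p) * 0 / (0 + ?p\<^sup>2 * ?q\<^sup>2)\<^sup>2"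
    unfolding bump'_def Let_def using assms by (intro tendsto_intros e) auto
  then show ?thesis using assms by simp
qed

text \<open>Near the end points \<open>bump'\<close> is not bounded uniformly in e: where p q is of
  the size of the square root of e, it can grow like the inverse of that root. A factor f dominated
  by the parabola x (l - x) compensates. With r = p q this parabola is at most r + e (l + 1), and
  the two resulting terms are controlled by \<open>r\<^sup>2 * e\<close> and
  \<open>e\<^sup>2\<close>, both at most \<open>(e + r\<^sup>2)\<^sup>2\<close>.\<close>

lemma mult_bump'_bound:
  assumes e: "0 < e" "e \<le> 1" and x: "0 < x" "x < l" and f: "\<bar>f\<bar> \<le> C * (x * (l - x))"
  shows "\<bar>f * bump' 0 l e x\<bar> \<le> C * (2 * l * (1 + (l + 1) * l\<^sup>2))"
proof -
  define p q where "p = max 0 (x - e)" and "q = max 0 (l - e - x)"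
  have C: "C \<ge> 0"
    using f x by (smt (verit) mult_pos_pos zero_le_mult_iff)
  have l: "l > 0" using x by simp
  have b: "bump' 0 l e x = 2 * (p * q) * (q - p) * e / (e + p\<^sup>2 * q\<^sup>2)\<^sup>2"
    by (simp add: bump'_def Let_def p_def q_def)
  show ?thesis
  proof (cases "p * q = 0")
    case True
    then show ?thesis unfolding b using C l by (auto intro!: mult_nonneg_nonneg add_nonneg_nonneg)
  next
    case False
    \<comment> \<open>As the product is nonzero, neither truncation is active, so p and q are the
      shifted distances of x to the end points.\<close>
    then have pq: "p > 0" "q > 0" "x = p + e" "l - x = q + e" "p + q \<le> l"
      using e unfolding p_def q_def by (auto simp: max_def split: if_splits)
    define r where "r = p * q"
    have r: "0 < r" "r \<le> l\<^sup>2"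
      using pq l unfolding r_def power2_eq_square by (auto intro!: mult_mono)
    define N where "N = (e + r\<^sup>2)\<^sup>2"
    have "e + r\<^sup>2 > 0" using e by (simp add: add_pos_nonneg)
    then have N: "N > 0" unfolding N_def by simp
    have "x * (l - x) = r + e * (p + q) + e * e"
      unfolding r_def using pq by (simp add: algebra_simps)
    also have "\<dots> \<le> r + e * l + e * 1"
      using pq e by (intro add_mono mult_left_mono) auto
    finally have xl: "x * (l - x) \<le> r + e * (l + 1)" by (simp add: algebra_simps)
    have N1: "r\<^sup>2 * e \<le> N" "e\<^sup>2 \<le> N"
      using e unfolding N_def power2_sum by auto
    have f': "\<bar>f\<bar> \<le> C * (r + e * (l + 1))"
      using f mult_left_mono[OF xl C] by linarith
    have "\<bar>f * bump' 0 l e x\<bar> = \<bar>f\<bar> * (2 * r * \<bar>q - p\<bar> * e / N)"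
      unfolding b N_def using pq e N unfolding N_def
      by (simp add: abs_mult r_def power_mult_distrib)
    also have "\<dots> \<le> (C * (r + e * (l + 1))) * (2 * r * l * e / N)"
      using f' pq e r N C l by (intro mult_mono divide_right_mono) auto
    also have "\<dots> = C * (2 * l * (r\<^sup>2 * e / N + (l + 1) * r * (e\<^sup>2 / N)))"
      by (simp add: power2_eq_square field_simps add_divide_distrib)
    also have "\<dots> \<le> C * (2 * l * (1 + (l + 1) * l\<^sup>2 * 1))"
      using N1 N C l r by (intro mult_left_mono add_mono mult_mono) auto
    finally show ?thesis by simp
  qed
qed

section \<open>Weak derivatives\<close>

lemma restr_lincomb:
  assumes "continuous_on UNIV f" "continuous_on UNIV g"
  shows "a *\<^sub>R restr l f + b *\<^sub>R restr l g = restr l (\<lambda>x. a * f x + b * g x)"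
  using assms by (simp add: restr_scale restr_add continuous_on_mult_left)

text \<open>The derivative vanishes off the support as well, because the complement of the closed
  interval is open and the function is identically 0 on it.\<close>

lemma C1cD:
  assumes "C1c l \<phi>"
  obtains a b where "(\<phi> has_real_derivative deriv \<phi> x) (at x)" "continuous_on UNIV (deriv \<phi>)"
    "0 < a" "b < l" "\<And>x. x \<notin> {a..b} \<Longrightarrow> \<phi> x = 0" "\<And>x. x \<notin> {a..b} \<Longrightarrow> deriv \<phi> x = 0"
proof -
  from assms obtain D a b where D: "\<And>x. (\<phi> has_vector_derivative D x) (at x)" "continuous_on UNIV D"
    and ab: "0 < a" "b < l" "\<And>x. x \<notin> {a..b} \<Longrightarrow> \<phi> x = 0"
    unfolding C1c_def C1_differentiable_on_def by auto
  have D': "(\<phi> has_real_derivative D x) (at x)" for x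
    using D(1) by (simp add: has_real_derivative_iff_has_vector_derivative)
  then have eq: "deriv \<phi> = D" by (auto intro!: DERIV_imp_deriv)
  have "deriv \<phi> x = 0" if "x \<notin> {a..b}" for x
  proof (rule DERIV_imp_deriv)
    have "((\<lambda>_. 0) has_real_derivative 0) (at x)" by simp
    then show "(\<phi> has_real_derivative 0) (at x)"
      by (rule has_field_derivative_transform_within_open[of _ _ _ "- {a..b}"]) (use that ab in auto)
  qed
  with that ab D' D(2) show ?thesis unfolding eq by blast
qed

lemma C1c_continuous: "C1c l \<phi> \<Longrightarrow> continuous_on UNIV \<phi>" "C1c l \<phi> \<Longrightarrow> continuous_on UNIV (deriv \<phi>)"
  by (metis C1cD continuous_at_imp_continuous_on DERIV_isCont) (metis C1cD)

text \<open>Test functions are already 0 outside the open interval, so the classes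
  \<open>abs_ltwo \<phi>\<close> in the definition of the weak derivative are instances of
  \<open>restr\<close>.\<close>

lemma C1c_indicator:
  assumes "C1c l \<phi>"
  shows "(\<lambda>x. indicator {0<..<l} x * \<phi> x) = \<phi>" "(\<lambda>x. indicator {0<..<l} x * deriv \<phi> x) = deriv \<phi>"
proof -
  obtain a b where ab: "0 < a" "b < l" "\<And>x. x \<notin> {a..b} \<Longrightarrow> \<phi> x = 0" "\<And>x. x \<notin> {a..b} \<Longrightarrow> deriv \<phi> x = 0"
    using C1cD[OF assms] by metis
  have z: "\<phi> x = 0" "deriv \<phi> x = 0" if "x \<notin> {0<..<l}" for x
    using ab that by (auto intro!: ab(3,4))
  then show "(\<lambda>x. indicator {0<..<l} x * \<phi> x) = \<phi>" "(\<lambda>x. indicator {0<..<l} x * deriv \<phi> x) = deriv \<phi>"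
    by (auto simp: fun_eq_iff indicator_def)
qed

lemma C1c_restr:
  assumes "C1c l \<phi>"
  shows "abs_ltwo \<phi> = restr l \<phi>" "abs_ltwo (deriv \<phi>) = restr l (deriv \<phi>)"
  by (simp_all add: restr_def C1c_indicator[OF assms])

text \<open>Integration by parts: the fundamental theorem is applied to the product f \<phi>, whose
  boundary values vanish because \<phi> is 0 at both end points.\<close>

lemma has_weak_deriv_restr:
  assumes l: "l > 0"
    and f: "\<And>x. (f has_real_derivative f' x) (at x)" and f': "continuous_on UNIV f'"
  shows "has_weak_deriv l (restr l f) (restr l f')"
  unfolding has_weak_deriv_def
proof (intro allI impI)
  fix \<phi> assume \<phi>: "C1c l \<phi>"
  have cf: "continuous_on UNIV f"
    using f by (auto intro!: continuous_at_imp_continuous_on DERIV_isCont)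
  obtain a b where d: "\<And>x. (\<phi> has_real_derivative deriv \<phi> x) (at x)"
    and ab: "0 < a" "b < l" "\<And>x. x \<notin> {a..b} \<Longrightarrow> \<phi> x = 0"
    using C1cD[OF \<phi>] by metis
  have z: "\<phi> 0 = 0" "\<phi> l = 0" using ab by auto
  have dp: "((\<lambda>x. f x * \<phi> x) has_real_derivative f x * deriv \<phi> x + f' x * \<phi> x) (at x)" for x
    using DERIV_mult[OF f d] by (simp add: add.commute mult.commute)
  have "((\<lambda>x. f x * deriv \<phi> x + f' x * \<phi> x) has_integral f l * \<phi> l - f 0 * \<phi> 0) {0..l}"
    by (rule fundamental_theorem_of_calculus)
      (use l dp in \<open>simp_all add: has_real_derivative_iff_has_vector_derivative[symmetric] has_field_derivative_at_within\<close>)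
  then have "integral {0..l} (\<lambda>x. f x * deriv \<phi> x + f' x * \<phi> x) = 0"
    using z by (auto dest: integral_unique)
  moreover have "integral {0..l} (\<lambda>x. f x * deriv \<phi> x + f' x * \<phi> x) =
     integral {0..l} (\<lambda>x. f x * deriv \<phi> x) + integral {0..l} (\<lambda>x. f' x * \<phi> x)"
    by (intro integral_add integrable_continuous_real continuous_intros
        continuous_on_subset[OF cf] continuous_on_subset[OF f'] 
        continuous_on_subset[OF C1c_continuous(1)[OF \<phi>]] continuous_on_subset[OF C1c_continuous(2)[OF \<phi>]]) auto
  ultimately show "inner (restr l f) (abs_ltwo (deriv \<phi>)) = - inner (restr l f') (abs_ltwo \<phi>)"
    using cf f' by (simp add: C1c_restr[OF \<phi>] inner_restr C1c_continuous[OF \<phi>])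
qed

text \<open>Serves two purposes: f = 1 on a subinterval gives the test functions that detect
  integrals over half-lines, and f on the whole interval gives the approximants that place f in
  \<open>H10 l\<close>.\<close>

lemma C1c_bump:
  assumes "0 \<le> a" "b \<le> l" "e > 0" and f: "\<And>x. (f has_real_derivative f' x) (at x)" and f': "continuous_on UNIV f'"
  shows "C1c l (\<lambda>x. f x * bump a b e x)"
    and "deriv (\<lambda>x. f x * bump a b e x) = (\<lambda>x. f' x * bump a b e x + f x * bump' a b e x)"
proof -
  have cf: "continuous_on UNIV f"
    using f by (auto intro!: continuous_at_imp_continuous_on DERIV_isCont)
  have d: "((\<lambda>x. f x * bump a b e x) has_real_derivative f' x * bump a b e x + f x * bump' a b e x) (at x)" for x
    using \<open>e > 0\<close> by (auto intro!: derivative_eq_intros f bump_deriv)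
  then show "deriv (\<lambda>x. f x * bump a b e x) = (\<lambda>x. f' x * bump a b e x + f x * bump' a b e x)"
    by (auto intro!: DERIV_imp_deriv)
  have "continuous_on UNIV (\<lambda>x. f' x * bump a b e x + f x * bump' a b e x)"
    by (intro continuous_intros cf f' continuous_bump continuous_bump' \<open>e > 0\<close>)
  with d have "(\<lambda>x. f x * bump a b e x) C1_differentiable_on UNIV"
    unfolding C1_differentiable_on_def
    by (intro exI[of _ "\<lambda>x. f' x * bump a b e x + f x * bump' a b e x"])
      (simp add: has_real_derivative_iff_has_vector_derivative)
  moreover have "\<exists>a' b'. 0 < a' \<and> b' < l \<and> (\<forall>x. x \<notin> {a'..b'} \<longrightarrow> f x * bump a b e x = 0)"
    using assms(1-3) bump_outside[of _ a e b] by (intro exI[of _ "a + e"] exI[of _ "b - e"]) auto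
  ultimately show "C1c l (\<lambda>x. f x * bump a b e x)" unfolding C1c_def by blast
qed

section \<open>Uniqueness of weak derivatives\<close>

lemma AE_zeroI_integrals_Ioi:
  fixes g :: "real \<Rightarrow> real"
  assumes g: "integrable lborel g" and z: "\<And>a. (LINT x|lborel. indicator {a<..} x * g x) = 0"
  shows "AE x in lborel. g x = 0"
proof -
  have [measurable]: "g \<in> borel_measurable borel" using g by (auto dest: borel_measurable_integrable)
  \<comment> \<open>\<open>ennreal\<close> sends negative reals to 0, so these are the positive and
    the negative part of g. Equality of the two at a point forces g = 0 there; hence it suffices to
    identify the measures that have them as densities.\<close>
  let ?p = "\<lambda>x. ennreal (g x)" and ?n = "\<lambda>x. ennreal (- g x)"
  let ?M = "density lborel ?p" and ?N = "density lborel ?n"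
  have fin: "(\<integral>\<^sup>+x. ?p x \<partial>lborel) < \<infinity>" "(\<integral>\<^sup>+x. ?n x \<partial>lborel) < \<infinity>"
    using g integrable_minus[OF g] by (auto simp: real_integrable_def less_top[symmetric])
  have M: "emeasure ?M {a<..} = (\<integral>\<^sup>+x. ennreal (indicator {a<..} x * g x) \<partial>lborel)"
    and N: "emeasure ?N {a<..} = (\<integral>\<^sup>+x. ennreal (- (indicator {a<..} x * g x)) \<partial>lborel)" for a
    by (auto simp: emeasure_density indicator_def intro!: nn_integral_cong)
  have finM: "emeasure ?M {a<..} < \<infinity>" and finN: "emeasure ?N {a<..} < \<infinity>" for a
    unfolding M N
    by (rule le_less_trans[OF nn_integral_mono fin(1)], simp add: indicator_def,
        rule le_less_trans[OF nn_integral_mono fin(2)], simp add: indicator_def)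
  \<comment> \<open>Half-lines determine a measure that is finite on them, and on a half-line the
    two values differ by the integral of g that is assumed to vanish.\<close>
  have "?M = ?N"
  proof (rule measure_eqI_lessThan)
    fix a
    show "emeasure ?M {a<..} < \<infinity>" by (rule finM)
    have "integrable lborel (\<lambda>x. indicator {a<..} x * g x)"
      by (rule Bochner_Integration.integrable_bound[OF g]) (auto simp: indicator_def)
    then have "enn2real (emeasure ?M {a<..}) - enn2real (emeasure ?N {a<..}) = 0"
      unfolding M N using z[of a] by (simp add: real_lebesgue_integral_def)
    with finM[of a] finN[of a] show "emeasure ?M {a<..} = emeasure ?N {a<..}"
      by (metis eq_iff_diff_eq_0 ennreal_enn2real less_top infinity_ennreal_def)
  qed auto
  then have "AE x in lborel. ?p x = ?n x"
    using fin(1) by (intro finite_density_unique[THEN iffD1]) auto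
  then show ?thesis
  proof eventually_elim
    case (elim x)
    then show ?case
      by (cases "g x \<ge> 0") (auto simp: ennreal_neg dest: antisym)
  qed
qed

text \<open>The fundamental lemma of the calculus of variations. The cutoffs of an interval with
  right end point l converge boundedly to its indicator, so by dominated convergence the integrals
  of v over all half-lines vanish.\<close>

lemma L2_on_eq_zeroI:
  assumes v: "v \<in> L2_on l" and z: "\<And>\<phi>. C1c l \<phi> \<Longrightarrow> inner v (abs_ltwo \<phi>) = 0"
  shows "v = 0"
proof -
  define g where "g x = indicator {0<..<l} x * rep_ltwo v x" for x
  have sq: "square_int (\<lambda>x. indicator {0<..<l} x * (1::real))"
    by (intro square_int_indicator) simp
  have g: "integrable lborel g"
    using square_int_mult[OF sq square_int_rep[of v]] by (simp add: g_def[abs_def])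
  have [measurable]: "g \<in> borel_measurable borel" using g by (auto dest: borel_measurable_integrable)
  have rg: "AE x in lborel. rep_ltwo v x = g x"
    using v unfolding L2_on_AE g_def .
  have ig: "inner v (abs_ltwo \<phi>) = (LINT x|lborel. g x * \<phi> x)" if "C1c l \<phi>" for \<phi>
  proof -
    have c: "continuous_on UNIV \<phi>" using that by (rule C1c_continuous)
    have [measurable]: "\<phi> \<in> borel_measurable borel" using c by (rule borel_measurable_continuous_onI)
    have [measurable]: "rep_ltwo v \<in> borel_measurable borel" using square_int_rep[of v] by (simp add: square_int_def)
    have "inner v (abs_ltwo \<phi>) = inner (abs_ltwo (rep_ltwo v)) (restr l \<phi>)"
      by (simp add: C1c_restr[OF that] abs_rep_ltwo)
    also have "\<dots> = (LINT x|lborel. rep_ltwo v x * (indicator {0<..<l} x * \<phi> x))"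
      unfolding restr_def using c by (intro inner_abs_ltwo square_int_rep square_int_indicator)
    also have "\<dots> = (LINT x|lborel. g x * \<phi> x)"
      by (rule Bochner_Integration.integral_cong) (auto simp: g_def)
    finally show ?thesis .
  qed
  have "(LINT x|lborel. indicator {a<..} x * g x) = 0" for a
  proof -
    \<comment> \<open>The cutoff must be supported inside (0, l). Since g vanishes to the left of 0,
      moving the end point a up to 0 does not change the limit integral.\<close>
    define a' where "a' = max a 0"
    let ?b = "\<lambda>k x. bump a' l (1 / Suc k) x"
    have "(\<lambda>k. LINT x|lborel. g x * ?b k x) \<longlonglongrightarrow> (LINT x|lborel. indicator {a<..} x * g x)"
    proof (rule integral_dominated_convergence[where w="\<lambda>x. norm (g x)"])
      show "integrable lborel (\<lambda>x. norm (g x))" using g by simp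
      fix k
      have [measurable]: "?b k \<in> borel_measurable borel"
        by (intro borel_measurable_continuous_onI continuous_bump) auto
      show "(\<lambda>x. g x * ?b k x) \<in> borel_measurable lborel" by measurable
      show "AE x in lborel. norm (g x * ?b k x) \<le> norm (g x)"
        using bump_bounds[of "1 / Suc k" a' l] by (auto simp: abs_mult intro!: mult_left_le)
    next
      have "(\<lambda>k. g x * ?b k x) \<longlonglongrightarrow> indicator {a<..} x * g x" for x
      proof (cases "a' < x \<and> x < l")
        case True
        then have "(\<lambda>k. g x * ?b k x) \<longlonglongrightarrow> g x * 1"
          by (intro tendsto_intros bump_tendsto) auto
        then show ?thesis using True by (auto simp: a'_def)
      next
        case False
        have "g x * ?b k x = 0" for k
        proof -
          have "1 / real (Suc k) > 0" by simp
          with False have "x \<notin> {a' + 1 / Suc k..l - 1 / Suc k}"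
            unfolding atLeastAtMost_iff by linarith
          from bump_outside[OF this] show ?thesis by (simp only: mult_zero_right)
        qed
        moreover have "indicator {a<..} x * g x = 0"
          using False by (auto simp: a'_def g_def indicator_def)
        ultimately show ?thesis by (simp only: tendsto_const)
      qed
      then show "AE x in lborel. (\<lambda>k. g x * ?b k x) \<longlonglongrightarrow> indicator {a<..} x * g x" by simp
    qed auto
    moreover have "(LINT x|lborel. g x * ?b k x) = 0" for k
    proof -
      have "C1c l (\<lambda>x. 1 * ?b k x)"
        by (rule C1c_bump(1)[where f'="\<lambda>_. 0"]) (auto simp: a'_def)
      then show ?thesis using ig z by auto
    qed
    ultimately show ?thesis by (simp add: LIMSEQ_const_iff)
  qed
  from AE_zeroI_integrals_Ioi[OF g this] have "AE x in lborel. rep_ltwo v x = 0"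
    using rg by eventually_elim simp
  then have "abs_ltwo (rep_ltwo v) = abs_ltwo (\<lambda>x. 0)"
    by (intro abs_ltwo_cong square_int_rep) auto
  then show ?thesis by (simp add: abs_rep_ltwo zero_ltwo_def)
qed

text \<open>The difference of two weak derivatives annihilates every test function. With this,
  \<open>wderiv\<close> can be computed by exhibiting any weak derivative in
  \<open>L2_on l\<close>.\<close>

lemma wderiv_eqI:
  assumes "v \<in> L2_on l" "has_weak_deriv l u v"
  shows "wderiv l u = v"
  unfolding wderiv_def
proof (rule the_equality)
  fix w assume w: "w \<in> L2_on l \<and> has_weak_deriv l u w"
  have "w - v = 0"
  proof (rule L2_on_eq_zeroI)
    show "w - v \<in> L2_on l" using w assms by (simp add: subspace_diff subspace_L2_on)
    show "inner (w - v) (abs_ltwo \<phi>) = 0" if "C1c l \<phi>" for \<phi>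
      using w assms(2) that unfolding has_weak_deriv_def by (auto simp: inner_diff_left)
  qed
  then show "w = v" by simp
qed (use assms in simp)

lemma wderiv_H1: "u \<in> H1 l \<Longrightarrow> wderiv l u \<in> L2_on l" "u \<in> H1 l \<Longrightarrow> has_weak_deriv l u (wderiv l u)"
  by (auto simp: H1_def wderiv_eqI)

lemma H1_restr:
  assumes "l > 0" "\<And>x. (f has_real_derivative f' x) (at x)" "continuous_on UNIV f'"
  shows "restr l f \<in> H1 l" "wderiv l (restr l f) = restr l f'"
proof -
  have cf: "continuous_on UNIV f"
    using assms(2) by (auto intro!: continuous_at_imp_continuous_on DERIV_isCont)
  show "restr l f \<in> H1 l" "wderiv l (restr l f) = restr l f'"
    using has_weak_deriv_restr[OF assms] restr_in_L2_on[OF cf] restr_in_L2_on[OF assms(3)]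
    by (auto simp: H1_def wderiv_eqI)
qed

lemma H1_C1c:
  assumes "l > 0" "C1c l \<phi>"
  shows "abs_ltwo \<phi> \<in> H1 l" "wderiv l (abs_ltwo \<phi>) = abs_ltwo (deriv \<phi>)"
proof -
  have d: "(\<phi> has_real_derivative deriv \<phi> x) (at x)" for x
    using C1cD[OF assms(2)] by metis
  show "abs_ltwo \<phi> \<in> H1 l" "wderiv l (abs_ltwo \<phi>) = abs_ltwo (deriv \<phi>)"
    using H1_restr[OF assms(1) d C1c_continuous(2)[OF assms(2)]] by (simp_all add: C1c_restr[OF assms(2)])
qed

lemma H1_lincomb:
  assumes "u \<in> H1 l" "v \<in> H1 l"
  shows "a *\<^sub>R u + b *\<^sub>R v \<in> H1 l"
    and "wderiv l (a *\<^sub>R u + b *\<^sub>R v) = a *\<^sub>R wderiv l u + b *\<^sub>R wderiv l v"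
proof -
  have "a *\<^sub>R wderiv l u + b *\<^sub>R wderiv l v \<in> L2_on l" "a *\<^sub>R u + b *\<^sub>R v \<in> L2_on l"
    using assms wderiv_H1 by (auto simp: H1_def intro!: subspace_add subspace_scale subspace_L2_on)
  moreover have "has_weak_deriv l (a *\<^sub>R u + b *\<^sub>R v) (a *\<^sub>R wderiv l u + b *\<^sub>R wderiv l v)"
    using assms[THEN wderiv_H1(2)] unfolding has_weak_deriv_def
    by (auto simp: inner_add_left algebra_simps)
  ultimately show "a *\<^sub>R u + b *\<^sub>R v \<in> H1 l"
    and "wderiv l (a *\<^sub>R u + b *\<^sub>R v) = a *\<^sub>R wderiv l u + b *\<^sub>R wderiv l v"
    unfolding H1_def by (blast, intro wderiv_eqI)
qed

lemma H1_diff: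
  assumes "u \<in> H1 l" "v \<in> H1 l"
  shows "u - v \<in> H1 l" "wderiv l (u - v) = wderiv l u - wderiv l v"
  using H1_lincomb[OF assms, of 1 "-1"] by simp_all

section \<open>Approximation by test functions\<close>

lemma tendsto_norm_minus_iff:
  fixes f :: "_ \<Rightarrow> 'a::real_normed_vector"
  shows "((\<lambda>k. norm (u - f k)) \<longlongrightarrow> 0) F \<longleftrightarrow> (f \<longlongrightarrow> u) F"
  by (subst tendsto_dist_iff[of f u]) (simp add: dist_norm norm_minus_commute)

text \<open>Linearity of \<open>wderiv\<close> splits convergence in the H^1 norm into L^2
  convergence of the functions and of their derivatives, a form in which limits pass through inner
  products.\<close>

lemma H10_iff:
  assumes l: "l > 0"
  shows "u \<in> H10 l \<longleftrightarrow> u \<in> H1 l \<and> (\<exists>\<phi>. (\<forall>k::nat. C1c l (\<phi> k)) \<and>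
     (\<lambda>k. abs_ltwo (\<phi> k)) \<longlonglongrightarrow> u \<and> (\<lambda>k. abs_ltwo (deriv (\<phi> k))) \<longlonglongrightarrow> wderiv l u)"
proof -
  have "(\<lambda>k. H1_norm l (u - abs_ltwo (\<phi> k))) \<longlonglongrightarrow> 0 \<longleftrightarrow>
     (\<lambda>k. abs_ltwo (\<phi> k)) \<longlonglongrightarrow> u \<and> (\<lambda>k. abs_ltwo (deriv (\<phi> k))) \<longlonglongrightarrow> wderiv l u"
    if u: "u \<in> H1 l" and \<phi>: "\<And>k. C1c l (\<phi> k)" for \<phi> :: "nat \<Rightarrow> real \<Rightarrow> real"
  proof -
    let ?x = "\<lambda>k. norm (u - abs_ltwo (\<phi> k))" and ?y = "\<lambda>k. norm (wderiv l u - abs_ltwo (deriv (\<phi> k)))"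
    have eq: "H1_norm l (u - abs_ltwo (\<phi> k)) = sqrt ((?x k)\<^sup>2 + (?y k)\<^sup>2)" for k
      unfolding H1_norm_def using u \<phi>[of k] l by (simp add: H1_diff H1_C1c)
    have "(\<lambda>k. sqrt ((?x k)\<^sup>2 + (?y k)\<^sup>2)) \<longlonglongrightarrow> 0 \<longleftrightarrow> ?x \<longlonglongrightarrow> 0 \<and> ?y \<longlonglongrightarrow> 0"
    proof safe
      assume c: "(\<lambda>k. sqrt ((?x k)\<^sup>2 + (?y k)\<^sup>2)) \<longlonglongrightarrow> 0"
      show "?x \<longlonglongrightarrow> 0" "?y \<longlonglongrightarrow> 0"
        by (rule tendsto_sandwich[OF _ _ tendsto_const c]; auto intro!: real_le_rsqrt)+
    next
      assume "?x \<longlonglongrightarrow> 0" "?y \<longlonglongrightarrow> 0"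
      then have "(\<lambda>k. sqrt ((?x k)\<^sup>2 + (?y k)\<^sup>2)) \<longlonglongrightarrow> sqrt (0\<^sup>2 + 0\<^sup>2)"
        by (intro tendsto_intros)
      then show "(\<lambda>k. sqrt ((?x k)\<^sup>2 + (?y k)\<^sup>2)) \<longlonglongrightarrow> 0" by simp
    qed
    then show ?thesis unfolding eq tendsto_norm_minus_iff .
  qed
  then show ?thesis unfolding H10_def by blast
qed

lemma H10_lincomb:
  assumes l: "l > 0" and u: "u \<in> H10 l" and v: "v \<in> H10 l"
  shows "a *\<^sub>R u + b *\<^sub>R v \<in> H10 l"
proof -
  from u v obtain \<phi> \<psi> where
    \<phi>: "\<And>k::nat. C1c l (\<phi> k)" "(\<lambda>k. abs_ltwo (\<phi> k)) \<longlonglongrightarrow> u" "(\<lambda>k. abs_ltwo (deriv (\<phi> k))) \<longlonglongrightarrow> wderiv l u" and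
    \<psi>: "\<And>k::nat. C1c l (\<psi> k)" "(\<lambda>k. abs_ltwo (\<psi> k)) \<longlonglongrightarrow> v" "(\<lambda>k. abs_ltwo (deriv (\<psi> k))) \<longlonglongrightarrow> wderiv l v"
    and H1: "u \<in> H1 l" "v \<in> H1 l"
    unfolding H10_iff[OF l] by blast
  let ?\<eta> = "\<lambda>k x. a * \<phi> k x + b * \<psi> k x"
  have dd: "((?\<eta> k) has_real_derivative a * deriv (\<phi> k) x + b * deriv (\<psi> k) x) (at x)" for k x
  proof -
    have "(\<phi> k has_real_derivative deriv (\<phi> k) x) (at x)" "(\<psi> k has_real_derivative deriv (\<psi> k) x) (at x)"
      using C1cD[OF \<phi>(1)] C1cD[OF \<psi>(1)] by metis+
    then show ?thesis by (intro DERIV_add DERIV_cmult)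
  qed
  have deta: "deriv (?\<eta> k) = (\<lambda>x. a * deriv (\<phi> k) x + b * deriv (\<psi> k) x)" for k
    using dd by (auto intro!: DERIV_imp_deriv)
  have C1c: "C1c l (?\<eta> k)" for k
  proof -
    have "(?\<eta> k) C1_differentiable_on UNIV"
      using dd[of k] C1c_continuous(2)[OF \<phi>(1)] C1c_continuous(2)[OF \<psi>(1)]
      unfolding C1_differentiable_on_def
      by (intro exI[of _ "\<lambda>x. a * deriv (\<phi> k) x + b * deriv (\<psi> k) x"])
        (auto simp: has_real_derivative_iff_has_vector_derivative intro!: continuous_intros)
    moreover obtain p q c d where ab: "0 < p" "q < l" "\<And>x. x \<notin> {p..q} \<Longrightarrow> \<phi> k x = 0"
      and cd: "0 < c" "d < l" "\<And>x. x \<notin> {c..d} \<Longrightarrow> \<psi> k x = 0"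
      using C1cD[OF \<phi>(1)] C1cD[OF \<psi>(1)] by metis
    \<comment> \<open>The hull of the two supports is again a compact interval inside (0,
      l).\<close>
    have "?\<eta> k x = 0" if "x \<notin> {min p c..max q d}" for x
    proof -
      have "x \<notin> {p..q}" "x \<notin> {c..d}" using that by auto
      then show ?thesis using ab(3) cd(3) by simp
    qed
    then have "\<exists>p q. 0 < p \<and> q < l \<and> (\<forall>x. x \<notin> {p..q} \<longrightarrow> ?\<eta> k x = 0)"
      using ab cd by (intro exI[of _ "min p c", OF exI[of _ "max q d"]]) simp
    ultimately show ?thesis unfolding C1c_def by blast
  qed
  have "(\<lambda>k. abs_ltwo (?\<eta> k)) = (\<lambda>k. a *\<^sub>R abs_ltwo (\<phi> k) + b *\<^sub>R abs_ltwo (\<psi> k))"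
    "(\<lambda>k. abs_ltwo (deriv (?\<eta> k))) = (\<lambda>k. a *\<^sub>R abs_ltwo (deriv (\<phi> k)) + b *\<^sub>R abs_ltwo (deriv (\<psi> k)))"
    unfolding C1c_restr[OF C1c] C1c_restr[OF \<phi>(1)] C1c_restr[OF \<psi>(1)] unfolding deta
    by (simp_all add: restr_lincomb C1c_continuous[OF \<phi>(1)] C1c_continuous[OF \<psi>(1)])
  moreover have "(\<lambda>k. a *\<^sub>R abs_ltwo (\<phi> k) + b *\<^sub>R abs_ltwo (\<psi> k)) \<longlonglongrightarrow> a *\<^sub>R u + b *\<^sub>R v"
    "(\<lambda>k. a *\<^sub>R abs_ltwo (deriv (\<phi> k)) + b *\<^sub>R abs_ltwo (deriv (\<psi> k))) \<longlonglongrightarrow> wderiv l (a *\<^sub>R u + b *\<^sub>R v)"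
    unfolding H1_lincomb[OF H1] by (intro tendsto_intros \<phi> \<psi>)+
  ultimately show ?thesis
    unfolding H10_iff[OF l] using H1_lincomb(1)[OF H1] C1c by (intro conjI exI[of _ ?\<eta>]) auto
qed

lemma Ldom_lincomb:
  assumes l: "l > 0" and u: "u \<in> Ldom l" "v \<in> Ldom l"
  shows "a *\<^sub>R u + b *\<^sub>R v \<in> Ldom l"
    and "Lop \<nu> lam l (a *\<^sub>R u + b *\<^sub>R v) = a *\<^sub>R Lop \<nu> lam l u + b *\<^sub>R Lop \<nu> lam l v"
  using u unfolding Ldom_def H2_def Lop_def
  by (auto simp: H10_lincomb[OF l] H1_lincomb algebra_simps)

lemma inner_wderiv2:
  assumes l: "l > 0" and u: "u \<in> Ldom l"
  shows "inner (wderiv l (wderiv l u)) u = - (norm (wderiv l u))\<^sup>2"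
proof -
  let ?v = "wderiv l u"
  have v: "?v \<in> H1 l" and "u \<in> H10 l" using u by (auto simp: Ldom_def H2_def)
  then obtain \<phi> where \<phi>: "\<And>k::nat. C1c l (\<phi> k)" "(\<lambda>k. abs_ltwo (\<phi> k)) \<longlonglongrightarrow> u"
      "(\<lambda>k. abs_ltwo (deriv (\<phi> k))) \<longlonglongrightarrow> ?v"
    unfolding H10_iff[OF l] by blast
  have "inner ?v (abs_ltwo (deriv (\<phi> k))) = - inner (wderiv l ?v) (abs_ltwo (\<phi> k))" for k
    using wderiv_H1(2)[OF v] \<phi>(1) unfolding has_weak_deriv_def by blast
  moreover have "(\<lambda>k. inner ?v (abs_ltwo (deriv (\<phi> k)))) \<longlonglongrightarrow> inner ?v ?v"
    "(\<lambda>k. - inner (wderiv l ?v) (abs_ltwo (\<phi> k))) \<longlonglongrightarrow> - inner (wderiv l ?v) u"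
    by (intro tendsto_intros \<phi>)+
  ultimately have "inner ?v ?v = - inner (wderiv l ?v) u"
    by (simp add: LIMSEQ_unique)
  then show ?thesis by (simp add: power2_norm_eq_inner)
qed

text \<open>Dominated convergence for the squared distance: the limit g inherits the bound K, so
  \<open>(2 * K)\<^sup>2\<close> on the bounded interval is an integrable majorant.\<close>

lemma restr_tendsto:
  assumes cf: "\<And>k::nat. continuous_on UNIV (f k)" "continuous_on UNIV g"
    and bd: "\<And>k x. 0 < x \<Longrightarrow> x < l \<Longrightarrow> \<bar>f k x\<bar> \<le> K"
    and lim: "\<And>x. 0 < x \<Longrightarrow> x < l \<Longrightarrow> (\<lambda>k. f k x) \<longlonglongrightarrow> g x"
  shows "(\<lambda>k. restr l (f k)) \<longlonglongrightarrow> restr l g"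
proof -
  have bg: "\<bar>g x\<bar> \<le> K" if "0 < x" "x < l" for x
    using tendsto_rabs[OF lim[OF that]] bd[OF that] by (intro LIMSEQ_le_const2) auto
  have [measurable]: "f k \<in> borel_measurable borel" "g \<in> borel_measurable borel" for k
    using cf by (auto intro: borel_measurable_continuous_onI)
  let ?h = "\<lambda>k x. indicator {0<..<l} x * (f k x - g x)\<^sup>2"
  have eq: "(norm (restr l (f k) - restr l g))\<^sup>2 = (LINT x|lborel. ?h k x)" for k
  proof -
    have c: "continuous_on UNIV (\<lambda>x. f k x - g x)" by (intro continuous_intros cf)
    have "restr l (f k) - restr l g = restr l (\<lambda>x. f k x - g x)"
      using restr_lincomb[OF cf(1)[of k] cf(2), of 1 l "-1"] by simp
    then have "(norm (restr l (f k) - restr l g))\<^sup>2 =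
        (LINT x|lborel. (indicator {0<..<l} x * (f k x - g x)) * (indicator {0<..<l} x * (f k x - g x)))"
      unfolding power2_norm_eq_inner
      by (simp only: restr_def inner_abs_ltwo[OF square_int_indicator[OF c] square_int_indicator[OF c]])
    also have "\<dots> = (LINT x|lborel. ?h k x)"
      by (rule Bochner_Integration.integral_cong) (auto simp: indicator_def power2_eq_square)
    finally show ?thesis .
  qed
  have "(\<lambda>k. LINT x|lborel. ?h k x) \<longlonglongrightarrow> (LINT x|(lborel :: real measure). (0::real))"
  proof (rule integral_dominated_convergence[where w="\<lambda>x. indicator {0..l} x * (2 * K)\<^sup>2"])
    have "set_integrable lborel {0..l} (\<lambda>x. (2 * K)\<^sup>2)"
      by (intro borel_integrable_atLeastAtMost' continuous_intros)
    then show "integrable lborel (\<lambda>x. indicator {0..l} x * (2 * K)\<^sup>2)"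
      by (simp add: set_integrable_def)
    show "AE x in lborel. (\<lambda>k. ?h k x) \<longlonglongrightarrow> 0"
    proof (rule AE_I2)
      fix x show "(\<lambda>k. ?h k x) \<longlonglongrightarrow> 0"
      proof (cases "0 < x \<and> x < l")
        case True
        then have "(\<lambda>k. ?h k x) \<longlonglongrightarrow> indicator {0<..<l} x * (g x - g x)\<^sup>2"
          by (intro tendsto_intros lim) auto
        then show ?thesis by simp
      next
        case False
        then have "?h k x = 0" for k by (simp add: indicator_def)
        then show ?thesis by (simp only: tendsto_const)
      qed
    qed
    show "AE x in lborel. norm (?h k x) \<le> indicator {0..l} x * (2 * K)\<^sup>2" for k
    proof (rule AE_I2)
      fix x
      have "(f k x - g x)\<^sup>2 \<le> (2 * K)\<^sup>2" if "0 < x" "x < l"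
        using bd[OF that, of k] bg[OF that] by (intro abs_le_square_iff[THEN iffD1]) auto
      then show "norm (?h k x) \<le> indicator {0..l} x * (2 * K)\<^sup>2"
        by (auto simp: indicator_def)
    qed
  qed auto
  then have "(\<lambda>k. (norm (restr l (f k) - restr l g))\<^sup>2) \<longlonglongrightarrow> 0"
    by (simp add: eq)
  from tendsto_real_sqrt[OF this] have "(\<lambda>k. norm (restr l (f k) - restr l g)) \<longlonglongrightarrow> 0" by simp
  then show ?thesis by (rule LIM_zero_cancel[OF tendsto_norm_zero_cancel])
qed

text \<open>The parabola bound is the quantitative form of the boundary condition. The derivative of
  f times a cutoff contains f \<open>bump'\<close>, which tends to 0 pointwise; only the parabola
  bound makes it bounded uniformly in k, so that it also tends to 0 in L^2.\<close>

lemma H10_restr: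
  assumes l: "l > 0" and f: "\<And>x. (f has_real_derivative f' x) (at x)" and f': "continuous_on UNIV f'"
    and bd: "\<And>x. 0 < x \<Longrightarrow> x < l \<Longrightarrow> \<bar>f x\<bar> \<le> C * (x * (l - x))"
  shows "restr l f \<in> H10 l"
proof -
  have cf: "continuous_on UNIV f"
    using f by (auto intro!: continuous_at_imp_continuous_on DERIV_isCont)
  have "compact (f ` {0..l})" "compact (f' ` {0..l})"
    by (intro compact_continuous_image continuous_on_subset[OF cf] continuous_on_subset[OF f']; simp)+
  then obtain K K' where K: "\<And>x. x \<in> {0..l} \<Longrightarrow> \<bar>f x\<bar> \<le> K" and K': "\<And>x. x \<in> {0..l} \<Longrightarrow> \<bar>f' x\<bar> \<le> K'"
    by (metis (no_types, lifting) bounded_iff compact_imp_bounded image_eqI real_norm_def)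
  let ?b = "\<lambda>k. bump 0 l (1 / Suc k)" and ?b' = "\<lambda>k. bump' 0 l (1 / Suc k)"
  have cb: "continuous_on UNIV (?b k)" "continuous_on UNIV (?b' k)" for k
    by (intro continuous_bump continuous_bump'; simp)+
  let ?\<phi> = "\<lambda>k x. f x * ?b k x"
  note C1c = C1c_bump(1)[of 0 l l "1 / Suc k" f f' for k, OF order_refl order_refl _ f f']
  note dC1c = C1c_bump(2)[of 0 l l "1 / Suc k" f f' for k, OF order_refl order_refl _ f f']
  have C: "C1c l (?\<phi> k)" and dC: "deriv (?\<phi> k) = (\<lambda>x. f' x * ?b k x + f x * ?b' k x)" for k
    by (rule C1c, simp, rule dC1c, simp)
  have b1: "\<bar>y * ?b k x\<bar> \<le> \<bar>y\<bar>" for k x y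
    using bump_bounds[of "1 / Suc k" 0 l x] by (auto simp: abs_mult intro!: mult_left_le)
  have "(\<lambda>k. restr l (?\<phi> k)) \<longlonglongrightarrow> restr l f"
  proof (rule restr_tendsto)
    show "\<bar>?\<phi> k x\<bar> \<le> K" if "0 < x" "x < l" for k x
      using b1[of "f x" k x] K[of x] that by simp
    show "(\<lambda>k. ?\<phi> k x) \<longlonglongrightarrow> f x" if "0 < x" "x < l" for x
      using tendsto_mult[OF tendsto_const bump_tendsto[OF that]] by simp
  qed (intro continuous_intros cf cb)+
  moreover have "(\<lambda>k. restr l (\<lambda>x. f' x * ?b k x + f x * ?b' k x)) \<longlonglongrightarrow> restr l f'"
  proof (rule restr_tendsto)
    \<comment> \<open>K' bounds the first summand because cutoffs are at most 1; the second bound is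
      \<open>mult_bump'_bound\<close> with e = 1 / (k + 1), which is at most 1.\<close>
    show "\<bar>f' x * ?b k x + f x * ?b' k x\<bar> \<le> K' + C * (2 * l * (1 + (l + 1) * l\<^sup>2))" if "0 < x" "x < l" for k x
      using b1[of "f' x" k x] K'[of x] mult_bump'_bound[of "1 / Suc k" x l "f x" C, OF _ _ that bd[OF that]] that
      by simp
    show "(\<lambda>k. f' x * ?b k x + f x * ?b' k x) \<longlonglongrightarrow> f' x" if "0 < x" "x < l" for x
      using tendsto_add[OF tendsto_mult[OF tendsto_const[of "f' x"] bump_tendsto[OF that]]
          tendsto_mult[OF tendsto_const[of "f x"] bump'_tendsto[OF that]]] by simp
  qed (intro continuous_intros cf f' cb)+
  ultimately have "(\<lambda>k. abs_ltwo (?\<phi> k)) \<longlonglongrightarrow> restr l f"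
      "(\<lambda>k. abs_ltwo (deriv (?\<phi> k))) \<longlonglongrightarrow> wderiv l (restr l f)"
    unfolding C1c_restr[OF C] H1_restr(2)[OF l f f'] unfolding dC by this+
  then show ?thesis
    unfolding H10_iff[OF l] using C H1_restr(1)[OF l f f'] by (intro conjI exI[of _ ?\<phi>]) auto
qed

section \<open>Sine eigenfunctions\<close>

lemma eigvec_restr: "eigvec l n = restr l (\<lambda>x. sqrt (2 / l) * sin (real n * pi * x / l))"
  by (simp add: eigvec_def restr_def)

text \<open>On the left half the bound of |sin t| by |t| suffices, since l - x is at least l / 2
  there; this is the origin of the factor 2. The reflection of x to l - x changes the sine at most
  by a sign and settles the right half.\<close>

lemma abs_sin_le_parabola:
  assumes "0 < x" "x < l"
  shows "\<bar>sin (real n * pi * x / l)\<bar> \<le> 2 * real n * pi / l\<^sup>2 * (x * (l - x))"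
proof -
  have l: "l > 0" using assms by simp
  have sym: "\<bar>sin (real n * pi * (l - x) / l)\<bar> = \<bar>sin (real n * pi * x / l)\<bar>"
  proof -
    have "real n * pi * (l - x) / l = real n * pi - real n * pi * x / l"
      using l by (simp add: field_simps)
    then show ?thesis by (simp add: sin_diff abs_mult)
  qed
  have half: "\<bar>sin (real n * pi * y / l)\<bar> \<le> 2 * real n * pi / l\<^sup>2 * (y * (l - y))" if y: "0 < y" "y \<le> l / 2" for y
  proof -
    have "\<bar>sin (real n * pi * y / l)\<bar> \<le> \<bar>real n * pi * y / l\<bar>" by (rule abs_sin_x_le_abs_x)
    also have "\<dots> = 2 * real n * pi / l\<^sup>2 * (y * (l / 2))"
      using y l by (simp add: power2_eq_square field_simps)
    also have "\<dots> \<le> 2 * real n * pi / l\<^sup>2 * (y * (l - y))"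
      using y l by (intro mult_left_mono) auto
    finally show ?thesis .
  qed
  show ?thesis
  proof (cases "x \<le> l / 2")
    case True then show ?thesis using half assms by simp
  next
    case False
    then show ?thesis using half[of "l - x"] assms unfolding sym by (simp add: mult.commute)
  qed
qed

lemma eigvec_wderiv:
  assumes l: "l > 0"
  shows "eigvec l n \<in> H1 l"
    and "wderiv l (eigvec l n) = restr l (\<lambda>x. sqrt (2 / l) * (real n * pi / l) * cos (real n * pi * x / l))"
proof -
  have d: "((\<lambda>x. sqrt (2 / l) * sin (real n * pi * x / l)) has_real_derivative
     sqrt (2 / l) * (real n * pi / l) * cos (real n * pi * x / l)) (at x)" for x
    using l by (auto intro!: derivative_eq_intros)
  have c: "continuous_on UNIV (\<lambda>x. sqrt (2 / l) * (real n * pi / l) * cos (real n * pi * x / l))"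
    using l by (intro continuous_intros) auto
  show "eigvec l n \<in> H1 l"
    and "wderiv l (eigvec l n) = restr l (\<lambda>x. sqrt (2 / l) * (real n * pi / l) * cos (real n * pi * x / l))"
    unfolding eigvec_restr by (rule H1_restr[OF l d c])+
qed

lemma eigvec_Ldom:
  assumes l: "l > 0"
  shows "eigvec l n \<in> Ldom l" and "Lop \<nu> lam l (eigvec l n) = eigval \<nu> lam l n *\<^sub>R eigvec l n"
proof -
  have d: "((\<lambda>x. sqrt (2 / l) * (real n * pi / l) * cos (real n * pi * x / l)) has_real_derivative
     - (real n * pi / l)\<^sup>2 * (sqrt (2 / l) * sin (real n * pi * x / l))) (at x)" for x
    using l by (auto intro!: derivative_eq_intros simp: power2_eq_square)
  have c': "continuous_on UNIV (\<lambda>x. sqrt (2 / l) * sin (real n * pi * x / l))"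
    using l by (intro continuous_intros) auto
  then have c: "continuous_on UNIV (\<lambda>x. - (real n * pi / l)\<^sup>2 * (sqrt (2 / l) * sin (real n * pi * x / l)))"
    by (rule continuous_on_mult_left)
  have w: "wderiv l (eigvec l n) \<in> H1 l" and w2: "wderiv l (wderiv l (eigvec l n)) = - (real n * pi / l)\<^sup>2 *\<^sub>R eigvec l n"
    unfolding eigvec_wderiv[OF l] unfolding H1_restr[OF l d c] eigvec_restr restr_scale[OF c']
    by (rule H1_restr[OF l d c], rule refl)
  show "Lop \<nu> lam l (eigvec l n) = eigval \<nu> lam l n *\<^sub>R eigvec l n"
    unfolding Lop_def w2 eigval_def by (simp add: algebra_simps power_mult_distrib power_divide flip: scaleR_diff_left)
  have "eigvec l n \<in> H10 l"
    unfolding eigvec_restr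
  proof (rule H10_restr[OF l, where C="sqrt (2 / l) * (2 * real n * pi / l\<^sup>2)"])
    show "((\<lambda>x. sqrt (2 / l) * sin (real n * pi * x / l)) has_real_derivative
       sqrt (2 / l) * (real n * pi / l) * cos (real n * pi * x / l)) (at x)" for x
      using l by (auto intro!: derivative_eq_intros)
    show "continuous_on UNIV (\<lambda>x. sqrt (2 / l) * (real n * pi / l) * cos (real n * pi * x / l))"
      using l by (intro continuous_intros) auto
    show "\<bar>sqrt (2 / l) * sin (real n * pi * x / l)\<bar> \<le> sqrt (2 / l) * (2 * real n * pi / l\<^sup>2) * (x * (l - x))"
      if "0 < x" "x < l" for x
      using mult_left_mono[OF abs_sin_le_parabola[OF that, of n], of "sqrt (2 / l)"] l
      by (simp add: abs_mult mult.assoc)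
  qed
  with w eigvec_wderiv(1)[OF l] show "eigvec l n \<in> Ldom l"
    by (simp add: Ldom_def H2_def)
qed

text \<open>k ranges over the integers because it will be a difference of two indices.\<close>

lemma integral_cos_pi:
  assumes "l > 0" "k \<noteq> 0"
  shows "((\<lambda>x. cos (of_int k * pi * x / l)) has_integral 0) {0..l}"
proof -
  let ?F = "\<lambda>x. sin (of_int k * pi * x / l) * (l / (of_int k * pi))"
  have "((\<lambda>x. cos (of_int k * pi * x / l)) has_integral ?F l - ?F 0) {0..l}"
    by (rule fundamental_theorem_of_calculus)
      (use assms in \<open>auto intro!: derivative_eq_intros simp: has_real_derivative_iff_has_vector_derivative[symmetric]\<close>)
  moreover have "?F l - ?F 0 = 0"
    using assms by (simp add: mult.commute[of _ pi])
  ultimately show ?thesis by metis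
qed

text \<open>The product formula for sines leaves cosines with indices m - n and m + n, and only
  index 0 has a nonzero integral. The assumption on n keeps m + n away from 0.\<close>

lemma inner_eigvec:
  assumes l: "l > 0" and n: "n \<ge> 1"
  shows "inner (eigvec l m) (eigvec l n) = (if m = n then 1 else 0)"
proof -
  have c: "continuous_on UNIV (\<lambda>x. sqrt (2 / l) * sin (real n * pi * x / l))" for n
    using l by (intro continuous_intros) auto
  let ?c = "\<lambda>k::int. \<lambda>x. cos (of_int k * pi * x / l)"
  have I: "(?c k has_integral (if k = 0 then l else 0)) {0..l}" for k
  proof (cases "k = 0")
    case True
    then show ?thesis using has_integral_const_real[of "1::real" 0 l] l by simp
  qed (use integral_cos_pi[OF l] in simp)
  have "inner (eigvec l m) (eigvec l n) =
     integral {0..l} (\<lambda>x. (sqrt (2 / l) * sin (real m * pi * x / l)) * (sqrt (2 / l) * sin (real n * pi * x / l)))"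
    unfolding eigvec_restr by (rule inner_restr[OF c c])
  also have "(\<lambda>x. (sqrt (2 / l) * sin (real m * pi * x / l)) * (sqrt (2 / l) * sin (real n * pi * x / l)))
      = (\<lambda>x. (1 / l) * (?c (int m - int n) x - ?c (int m + int n) x))"
  proof
    fix x
    have "sqrt (2 / l) * sqrt (2 / l) = 2 / l" using l by simp
    moreover have "(c * p) * (c * q) = (c * c) * (p * q)" for c p q :: real by (simp add: ac_simps)
    ultimately have "(sqrt (2 / l) * sin (real m * pi * x / l)) * (sqrt (2 / l) * sin (real n * pi * x / l))
      = 2 / l * (sin (real m * pi * x / l) * sin (real n * pi * x / l))"
      by presburger
    then show "(sqrt (2 / l) * sin (real m * pi * x / l)) * (sqrt (2 / l) * sin (real n * pi * x / l))
      = (1 / l) * (?c (int m - int n) x - ?c (int m + int n) x)"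
      unfolding sin_times_sin using l by (simp add: algebra_simps diff_divide_distrib add_divide_distrib)
  qed
  also have "integral {0..l} \<dots> = (1 / l) * ((if int m - int n = 0 then l else 0) - (if int m + int n = 0 then l else 0))"
    by (intro integral_unique has_integral_mult_right has_integral_diff I)
  also have "\<dots> = (if m = n then 1 else 0)" using l n by auto
  finally show ?thesis .
qed

section \<open>Spectral projections\<close>

text \<open>The difference of two candidates lies in V and is orthogonal to both residuals, hence to
  itself.\<close>

lemma orth_proj_eqI:
  assumes V: "subspace V" and p: "p \<in> V" "\<And>v. v \<in> V \<Longrightarrow> orthogonal (u - p) v"
  shows "orth_proj V u = p"
  unfolding orth_proj_def
proof (rule the_equality)
  fix q assume q: "q \<in> V \<and> (\<forall>v\<in>V. orthogonal (u - q) v)"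
  then have "q - p \<in> V" using V p by (simp add: subspace_diff)
  then have "inner (u - p) (q - p) = 0" "inner (u - q) (q - p) = 0"
    using p q by (auto simp: orthogonal_def)
  then have "inner (q - p) (q - p) = 0" by (simp add: inner_diff_left)
  then show "q = p" by simp
qed (use p in simp)

lemma Hc_lincomb: "a *\<^sub>R eigvec l 1 + b *\<^sub>R eigvec l 2 \<in> Hc l"
  unfolding Hc_def by (intro span_add span_scale span_base) auto

lemma Hc_cases:
  assumes "u \<in> Hc l"
  obtains a b where "u = a *\<^sub>R eigvec l 1 + b *\<^sub>R eigvec l 2"
  using assms unfolding Hc_def span_insert by (auto simp: algebra_simps)

lemma eigvec_L2: "l > 0 \<Longrightarrow> eigvec l n \<in> L2_on l"
  unfolding eigvec_restr by (intro restr_in_L2_on continuous_intros) auto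

lemma Pc_eq:
  assumes l: "l > 0"
  shows "Pc l u = inner u (eigvec l 1) *\<^sub>R eigvec l 1 + inner u (eigvec l 2) *\<^sub>R eigvec l 2"
proof (rule orth_proj_eqI)
  show "subspace (Hc l)" by (simp add: Hc_def)
  fix v assume "v \<in> Hc l"
  then show "orthogonal (u - (inner u (eigvec l 1) *\<^sub>R eigvec l 1 + inner u (eigvec l 2) *\<^sub>R eigvec l 2)) v"
    by (elim Hc_cases) (simp add: orthogonal_def inner_diff_left inner_add_left inner_add_right inner_eigvec[OF l])
qed (rule Hc_lincomb)

lemma Hs_iff:
  "u \<in> Hs l \<longleftrightarrow> u \<in> L2_on l \<and> inner u (eigvec l 1) = 0 \<and> inner u (eigvec l 2) = 0"
proof -
  have "eigvec l 1 \<in> Hc l" "eigvec l 2 \<in> Hc l"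
    using Hc_lincomb[of 1 l 0] Hc_lincomb[of 0 l 1] by simp_all
  then show ?thesis
    unfolding Hs_def by (fastforce simp: orthogonal_def inner_add_right simp del: One_nat_def elim: Hc_cases)
qed

lemma Hs_lincomb: "u \<in> Hs l \<Longrightarrow> v \<in> Hs l \<Longrightarrow> a *\<^sub>R u + b *\<^sub>R v \<in> Hs l"
  unfolding Hs_iff by (auto simp: inner_add_left intro!: subspace_add subspace_scale subspace_L2_on)

text \<open>\<open>Hs l\<close> is the complement of \<open>Hc l\<close> inside
  \<open>L2_on l\<close> and not inside the whole of L^2 of the line, which is why u has to vanish
  outside the interval.\<close>

lemma Ps_eq:
  assumes l: "l > 0" and u: "u \<in> L2_on l"
  shows "Ps l u = u - Pc l u"
proof (rule orth_proj_eqI)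
  show "subspace (Hs l)"
  proof (rule subspaceI)
    show "0 \<in> Hs l" by (simp add: Hs_iff subspace_0 subspace_L2_on)
  qed (use Hs_lincomb[of _ l _ 1 1] Hs_lincomb[of _ l _ _ 0] in simp_all)
  show "u - Pc l u \<in> Hs l"
    unfolding Hs_iff Pc_eq[OF l]
    by (auto simp: inner_diff_left inner_add_left inner_eigvec[OF l]
        intro!: subspace_diff subspace_add subspace_scale subspace_L2_on u eigvec_L2 l)
  fix v assume "v \<in> Hs l"
  then show "orthogonal (u - (u - Pc l u)) v"
    unfolding Hs_iff Pc_eq[OF l] by (simp add: orthogonal_def inner_add_right inner_commute)
qed

lemma Lop_L2:
  assumes "y \<in> Ldom l"
  shows "Lop \<nu> lam l y \<in> L2_on l"
  using assms wderiv_H1 unfolding Ldom_def H2_def Lop_def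
  by (auto simp: H1_def intro!: subspace_add subspace_scale subspace_L2_on)

lemma Ls_eq:
  assumes "l > 0" "y \<in> Ldom l"
  shows "Ls \<nu> lam l y = Lop \<nu> lam l y - (inner (Lop \<nu> lam l y) (eigvec l 1) *\<^sub>R eigvec l 1 + inner (Lop \<nu> lam l y) (eigvec l 2) *\<^sub>R eigvec l 2)"
  unfolding Ls_def by (simp add: Ps_eq Pc_eq Lop_L2 assms)

lemma Ls_lincomb:
  assumes "l > 0" "u \<in> Ldom l" "v \<in> Ldom l"
  shows "Ls \<nu> lam l (a *\<^sub>R u + b *\<^sub>R v) = a *\<^sub>R Ls \<nu> lam l u + b *\<^sub>R Ls \<nu> lam l v"
  using Ldom_lincomb[OF assms] by (simp add: Ls_eq assms inner_add_left algebra_simps)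

text \<open>Against y in \<open>Hs l\<close> the projection in \<open>Ls\<close> is invisible, so
  \<open>Lop\<close> can take its place. Its second-order part contributes a nonpositive multiple of
  the squared norm of the derivative, which is dropped.\<close>

lemma inner_Ls_le:
  assumes l: "l > 0" and \<nu>: "\<nu> \<ge> 0" and y: "y \<in> Ldom l \<inter> Hs l"
  shows "inner y (Ls \<nu> lam l y) \<le> lam * (norm y)\<^sup>2"
proof -
  have yD: "y \<in> Ldom l" using y by simp
  have "inner y (eigvec l 1) = 0" "inner y (eigvec l 2) = 0" using y by (auto simp: Hs_iff)
  then have "inner y (Ls \<nu> lam l y) = inner (Lop \<nu> lam l y) y"
    by (simp add: Ls_eq[OF l yD] inner_diff_right inner_add_right inner_commute)
  also have "\<dots> = \<nu> * (- (norm (wderiv l y))\<^sup>2) + lam * (norm y)\<^sup>2"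
    using inner_wderiv2[OF l, of y] y by (simp add: Lop_def inner_add_left power2_norm_eq_inner)
  also have "\<dots> \<le> lam * (norm y)\<^sup>2" using \<nu> by simp
  finally show ?thesis .
qed

lemma Ls_eigvec:
  assumes "l > 0" "n > 2"
  shows "Ls \<nu> lam l (eigvec l n) = eigval \<nu> lam l n *\<^sub>R eigvec l n"
  using assms by (simp add: Ls_eq eigvec_Ldom inner_eigvec)

lemma eigvec_Hs: "l > 0 \<Longrightarrow> n > 2 \<Longrightarrow> eigvec l n \<in> Hs l"
  by (simp add: Hs_iff eigvec_L2 inner_eigvec)

lemma Lc_eq:
  assumes l: "l > 0"
  shows "Lc \<nu> lam l (a *\<^sub>R eigvec l 1 + b *\<^sub>R eigvec l 2) =
    (eigval \<nu> lam l 1 * a) *\<^sub>R eigvec l 1 + (eigval \<nu> lam l 2 * b) *\<^sub>R eigvec l 2"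
  unfolding Lc_def Ldom_lincomb(2)[OF l eigvec_Ldom(1)[OF l] eigvec_Ldom(1)[OF l]] Pc_eq[OF l]
  by (simp add: eigvec_Ldom(2)[OF l] inner_add_left inner_eigvec[OF l] mult.commute)

section \<open>The quadratic term on the critical plane\<close>

lemma square_int_cong_AE:
  assumes "square_int g" "f \<in> borel_measurable borel" "AE x in lborel. f x = g x"
  shows "square_int f"
proof -
  have "integrable lborel (\<lambda>x. (f x)\<^sup>2) \<longleftrightarrow> integrable lborel (\<lambda>x. (g x)\<^sup>2)"
    using assms by (intro integrable_cong_AE) (auto simp: square_int_def elim!: eventually_mono)
  then show ?thesis using assms by (simp add: square_int_def)
qed

lemma Bop_Hc:
  fixes a b :: real
  assumes l: "l > 0" and \<alpha>: "\<alpha> = \<gamma> * pi / (sqrt 2 * l powr (3 / 2))"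
  defines "u \<equiv> a *\<^sub>R eigvec l 1 + b *\<^sub>R eigvec l 2"
  shows "Bop \<gamma> l u u = ((\<alpha> * a * b) *\<^sub>R eigvec l 1 + (- \<alpha> * a\<^sup>2) *\<^sub>R eigvec l 2) +
     ((- 3 * \<alpha> * a * b) *\<^sub>R eigvec l 3 + (- 2 * \<alpha> * b\<^sup>2) *\<^sub>R eigvec l 4)"
proof -
  let ?s = "\<lambda>n x. sqrt (2 / l) * sin (real n * pi * x / l)"
  let ?c = "\<lambda>n x. sqrt (2 / l) * (real n * pi / l) * cos (real n * pi * x / l)"
  let ?f = "\<lambda>x. a * ?s 1 x + b * ?s 2 x" and ?f' = "\<lambda>x. a * ?c 1 x + b * ?c 2 x"
  have cs: "continuous_on UNIV (?s n)" and cc: "continuous_on UNIV (?c n)" for n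
    using l by (intro continuous_intros; simp)+
  have cf: "continuous_on UNIV ?f" and cf': "continuous_on UNIV ?f'"
    by (intro continuous_on_add continuous_on_mult_left cs cc)+
  have cff: "continuous_on UNIV (\<lambda>x. - \<gamma> * ?f x * ?f' x)"
    by (rule continuous_on_mult[OF continuous_on_mult_left[OF cf] cf'])
  have u: "u = restr l ?f"
    unfolding u_def eigvec_restr by (rule restr_lincomb[OF cs cs])
  have wu: "wderiv l u = restr l ?f'"
    unfolding u_def H1_lincomb[OF eigvec_wderiv(1)[OF l] eigvec_wderiv(1)[OF l]] eigvec_wderiv(2)[OF l]
    by (rule restr_lincomb[OF cc cc])
  \<comment> \<open>\<open>Bop\<close> multiplies chosen representatives, and the square
    integrability of their product is not evident. It is inherited from the explicit product, with
    which it agrees almost everywhere.\<close>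
  have ae: "AE x in lborel. - \<gamma> * rep_ltwo u x * rep_ltwo (wderiv l u) x = indicator {0<..<l} x * (- \<gamma> * ?f x * ?f' x)"
    using rep_restr[OF cf, of l] rep_restr[OF cf', of l] unfolding u[symmetric] wu[symmetric]
    by eventually_elim (auto simp: indicator_def)
  have [measurable]: "rep_ltwo w \<in> borel_measurable borel" for w
    using square_int_rep[of w] by (simp add: square_int_def)
  have "Bop \<gamma> l u u = restr l (\<lambda>x. - \<gamma> * ?f x * ?f' x)"
    unfolding Bop_def restr_def
    by (intro abs_ltwo_cong square_int_indicator cff ae square_int_cong_AE[OF square_int_indicator[OF cff] _ ae]) measurable
  \<comment> \<open>The coefficients 1 give the right-hand side the shape of
    \<open>restr_lincomb\<close>.\<close>
  also have "(\<lambda>x. - \<gamma> * ?f x * ?f' x) = (\<lambda>x. 1 * ((\<alpha> * a * b) * ?s 1 x + (- \<alpha> * a\<^sup>2) * ?s 2 x) +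
     1 * ((- 3 * \<alpha> * a * b) * ?s 3 x + (- 2 * \<alpha> * b\<^sup>2) * ?s 4 x))"
  proof
    fix x
    define t where "t = pi * x / l"
    define r where "r = sqrt (2 / l)"
    have "l powr (3 / 2) = l powr (1 + 1 / 2)" by simp
    then have "l powr (3 / 2) = l powr 1 * l powr (1 / 2)" by (simp only: powr_add)
    then have lp: "l powr (3 / 2) = l * sqrt l" using l by (simp add: powr_half_sqrt)
    \<comment> \<open>A product of two eigenfunctions has two factors \<open>sqrt (2 / l)\<close>.
      One belongs to the resulting eigenfunctions; the other, with \<gamma> and the \<pi> / l of the
      derivative, makes 2 \<alpha>.\<close>
    have g: "\<gamma> * sqrt (2 / l) * (pi / l) = 2 * \<alpha>"
      unfolding \<alpha> lp using l by (simp add: real_sqrt_divide field_simps)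
    \<comment> \<open>Each multiple-angle sine is written as \<open>sin t\<close> times a polynomial
      in \<open>cos t\<close>, so that the trigonometric identity becomes a polynomial one in these
      two quantities.\<close>
    have s2: "sin (2 * t) = 2 * sin t * cos t" and c2: "cos (2 * t) = 2 * (cos t)\<^sup>2 - 1"
      by (simp_all add: sin_double cos_double_cos)
    have s3: "sin (3 * t) = sin t * (4 * (cos t)\<^sup>2 - 1)"
    proof -
      have "sin (3 * t) = sin (2 * t + t)" by (simp add: algebra_simps)
      also have "\<dots> = sin t * (4 * (cos t)\<^sup>2 - 1)"
        unfolding sin_add s2 c2 by (simp add: algebra_simps power2_eq_square)
      finally show ?thesis .
    qed
    have s4: "sin (4 * t) = 4 * sin t * cos t * (2 * (cos t)\<^sup>2 - 1)"
    proof -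
      have "sin (4 * t) = sin (2 * (2 * t))" by (simp add: algebra_simps)
      also have "\<dots> = 4 * sin t * cos t * (2 * (cos t)\<^sup>2 - 1)"
        unfolding sin_double c2 by (simp add: algebra_simps)
      finally show ?thesis .
    qed
    have "- \<gamma> * ?f x * ?f' x = - (\<gamma> * sqrt (2 / l) * (pi / l)) * sqrt (2 / l) * (a * sin t + b * sin (2 * t)) * (a * cos t + b * (2 * cos (2 * t)))"
      unfolding t_def r_def[symmetric] by (simp add: algebra_simps)
    also have "\<dots> = sqrt (2 / l) * (- (2 * \<alpha>) * (a * sin t + b * sin (2 * t)) * (a * cos t + b * (2 * cos (2 * t))))"
      unfolding g by simp
    also have "- (2 * \<alpha>) * (a * sin t + b * sin (2 * t)) * (a * cos t + b * (2 * cos (2 * t))) =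
       (\<alpha> * a * b) * sin t + (- \<alpha> * a\<^sup>2) * sin (2 * t) + ((- 3 * \<alpha> * a * b) * sin (3 * t) + (- 2 * \<alpha> * b\<^sup>2) * sin (4 * t))"
      unfolding s2 c2 s3 s4 by algebra
    also have "sqrt (2 / l) * \<dots> = 1 * ((\<alpha> * a * b) * ?s 1 x + (- \<alpha> * a\<^sup>2) * ?s 2 x) +
     1 * ((- 3 * \<alpha> * a * b) * ?s 3 x + (- 2 * \<alpha> * b\<^sup>2) * ?s 4 x)"
      unfolding t_def by (simp add: algebra_simps)
    finally show "- \<gamma> * ?f x * ?f' x = 1 * ((\<alpha> * a * b) * ?s 1 x + (- \<alpha> * a\<^sup>2) * ?s 2 x) +
     1 * ((- 3 * \<alpha> * a * b) * ?s 3 x + (- 2 * \<alpha> * b\<^sup>2) * ?s 4 x)" .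
  qed
  also have "restr l \<dots> = 1 *\<^sub>R ((\<alpha> * a * b) *\<^sub>R eigvec l 1 + (- \<alpha> * a\<^sup>2) *\<^sub>R eigvec l 2) +
     1 *\<^sub>R ((- 3 * \<alpha> * a * b) *\<^sub>R eigvec l 3 + (- 2 * \<alpha> * b\<^sup>2) *\<^sub>R eigvec l 4)"
    unfolding eigvec_restr restr_lincomb[OF cs cs]
    by (rule restr_lincomb[symmetric]; intro continuous_on_add continuous_on_mult_left cs)
  finally show ?thesis by simp
qed

section \<open>Energy estimate\<close>

text \<open>Gronwall's argument: the weight \<open>exp (- 2 * C * s)\<close> makes the squared norm
  nonincreasing. Derivatives are required only in the interior, so that curves that are merely
  continuous at the initial time, as in \<open>semigroup_op\<close>, are covered.\<close>

lemma energy_zero: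
  fixes w :: "real \<Rightarrow> 'a::real_inner"
  assumes ab: "a \<le> b" and cont: "continuous_on {a..b} w"
    and w': "\<And>s. a < s \<Longrightarrow> s < b \<Longrightarrow> (w has_vector_derivative D s) (at s)"
    and D: "\<And>s. a < s \<Longrightarrow> s < b \<Longrightarrow> inner (w s) (D s) \<le> C * (norm (w s))\<^sup>2"
    and 0: "w a = 0"
  shows "w b = 0"
proof -
  let ?g = "\<lambda>s. inner (w s) (w s) * exp (- 2 * C * s)"
  have "?g b \<le> ?g a"
  proof (rule DERIV_nonpos_imp_decreasing_open[OF ab])
    show "continuous_on {a..b} ?g" by (intro continuous_intros cont)
    fix s assume s: "a < s" "s < b"
    have "((\<lambda>s. inner (w s) (w s)) has_real_derivative inner (w s) (D s) + inner (D s) (w s)) (at s)"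
      using bounded_bilinear.has_vector_derivative[OF bounded_bilinear_inner w'[OF s] w'[OF s]]
      by (simp add: has_real_derivative_iff_has_vector_derivative)
    then have "(?g has_real_derivative (inner (w s) (D s) + inner (D s) (w s)) * exp (- 2 * C * s)
        + inner (w s) (w s) * (exp (- 2 * C * s) * (- 2 * C))) (at s)"
      by (auto intro!: derivative_eq_intros)
    moreover have "(inner (w s) (D s) + inner (D s) (w s)) * exp (- 2 * C * s)
        + inner (w s) (w s) * (exp (- 2 * C * s) * (- 2 * C)) =
        2 * (inner (w s) (D s) - C * (norm (w s))\<^sup>2) * exp (- 2 * C * s)"
      by (simp add: inner_commute power2_norm_eq_inner algebra_simps)
    moreover have "\<dots> \<le> 0" using D[OF s] by (simp add: mult_nonpos_nonneg)
    ultimately show "\<exists>y. (?g has_real_derivative y) (at s) \<and> y \<le> 0" by metis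
  qed
  with 0 have "inner (w b) (w b) * exp (- 2 * C * b) \<le> 0" by simp
  then show ?thesis by (metis exp_gt_zero inner_gt_zero_iff linorder_not_less mult_pos_pos)
qed

section \<open>Exponential integrals\<close>

lemma orthonormal_pair_norm:
  assumes "l > 0" "m \<ge> 1" "n \<ge> 1" "m \<noteq> n"
  shows "(norm (p *\<^sub>R eigvec l m + q *\<^sub>R eigvec l n))\<^sup>2 = p\<^sup>2 + q\<^sup>2"
  unfolding power2_norm_eq_inner
  using assms by (simp add: inner_add_left inner_add_right inner_eigvec power2_eq_square)

lemma has_vector_derivative_pair:
  fixes u v :: "'a::real_normed_vector"
  assumes "(p has_real_derivative p') (at s)" "(q has_real_derivative q') (at s)"
  shows "((\<lambda>s. p s *\<^sub>R u + q s *\<^sub>R v) has_vector_derivative p' *\<^sub>R u + q' *\<^sub>R v) (at s)"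
  using assms by (auto intro!: derivative_eq_intros)

definition expint :: "real \<Rightarrow> real \<Rightarrow> real" where
  "expint b s = (if b = 0 then s else (exp (b * s) - 1) / b)"

lemma expint_0 [simp]: "expint b 0 = 0"
  by (simp add: expint_def)

lemma expint_deriv: "(expint b has_real_derivative exp (b * s)) (at s)"
  unfolding expint_def by (cases "b = 0") (auto intro!: derivative_eq_intros)

text \<open>For negative s the integral from 0 runs backward. The sign matters because integrability
  on the half-line is derived for integrands of one sign.\<close>

lemma expint_nonpos: "s \<le> 0 \<Longrightarrow> expint b s \<le> 0"
  unfolding expint_def by (cases b "0::real" rule: linorder_cases) (auto simp: divide_simps mult_nonneg_nonpos mult_nonpos_nonpos)

text \<open>The outcome of integrating \<open>expint b s * exp (c * s)\<close> by parts, normalized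
  to vanish at minus infinity.\<close>

definition expint_prim :: "real \<Rightarrow> real \<Rightarrow> real \<Rightarrow> real" where
  "expint_prim b c s = expint b s * exp (c * s) / c - exp ((c + b) * s) / (c * (c + b))"

lemma expint_prim_deriv:
  assumes "c \<noteq> 0" "c + b \<noteq> 0"
  shows "(expint_prim b c has_real_derivative expint b s * exp (c * s)) (at s)"
proof -
  have "(expint_prim b c has_real_derivative
     (exp (b * s) * exp (c * s) + expint b s * (exp (c * s) * c)) / c - exp ((c + b) * s) * (c + b) / (c * (c + b))) (at s)"
    unfolding expint_prim_def[abs_def] using assms by (auto intro!: derivative_eq_intros expint_deriv)
  moreover have "exp ((c + b) * s) = exp (b * s) * exp (c * s)"
    by (simp add: algebra_simps flip: exp_add)
  ultimately show ?thesis using assms by (simp add: add_divide_distrib)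
qed

lemma exp_mult_at_bot: "c > 0 \<Longrightarrow> ((\<lambda>s::real. exp (c * s)) \<longlongrightarrow> 0) at_bot"
  by (intro filterlim_compose[OF exp_at_bot] filterlim_tendsto_pos_mult_at_bot[of _ c] tendsto_const filterlim_ident)

lemma expint_exp_at_bot:
  assumes "c > 0" "c + b > 0"
  shows "((\<lambda>s. expint b s * exp (c * s)) \<longlongrightarrow> 0) at_bot"
proof (cases "b = 0")
  case False
  have "((\<lambda>s. (exp ((c + b) * s) - exp (c * s)) / b) \<longlongrightarrow> (0 - 0) / b) at_bot"
    using False assms by (intro tendsto_intros exp_mult_at_bot) auto
  then show ?thesis
    using False by (simp add: expint_def algebra_simps exp_add)
next
  case True
  have "((\<lambda>s::real. s * exp (c * s)) \<longlongrightarrow> 0) at_bot"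
  proof (rule tendsto_sandwich[OF _ _ _ tendsto_const])
    show "((\<lambda>s. - (2 / c) * exp (c / 2 * s)) \<longlongrightarrow> 0) at_bot"
      using assms tendsto_mult[OF tendsto_const[of "- (2 / c)"] exp_mult_at_bot[of "c / 2"]] by simp
    \<comment> \<open>Half of the decay rate is spent on the linear factor: u \<le> exp u with u = -
      c s / 2.\<close>
    have "- (2 / c) * exp (c / 2 * s) \<le> s * exp (c * s)" for s
    proof -
      have "- (c / 2 * s) \<le> exp (- (c / 2 * s))"
        using exp_ge_add_one_self[of "- (c / 2 * s)"] by linarith
      then have "(2 / c) * (- (c / 2 * s)) * exp (c * s) \<le> (2 / c) * exp (- (c / 2 * s)) * exp (c * s)"
        using assms by (intro mult_right_mono mult_left_mono) auto
      moreover have "exp (- (c / 2 * s)) * exp (c * s) = exp (c / 2 * s)"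
        by (simp flip: exp_add)
      ultimately show ?thesis using assms by (simp add: mult.assoc)
    qed
    then show "\<forall>\<^sub>F s in at_bot. - (2 / c) * exp (c / 2 * s) \<le> s * exp (c * s)" by simp
    show "\<forall>\<^sub>F s::real in at_bot. s * exp (c * s) \<le> 0"
      using eventually_le_at_bot[of "0::real"] by eventually_elim (simp add: mult_nonpos_nonneg)
  qed
  then show ?thesis using True by (simp add: expint_def)
qed

lemma expint_prim_at_bot:
  assumes "c > 0" "c + b > 0"
  shows "(expint_prim b c \<longlongrightarrow> 0) at_bot"
proof -
  have "(expint_prim b c \<longlongrightarrow> 0 / c - 0 / (c * (c + b))) at_bot"
    unfolding expint_prim_def[abs_def] using assms
    by (intro tendsto_intros expint_exp_at_bot exp_mult_at_bot) auto
  then show ?thesis by simp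
qed

section \<open>Integrals over the negative half-line\<close>

lemma set_integrable_FTC_at_bot:
  fixes f F :: "real \<Rightarrow> real"
  assumes F: "\<And>x. (F has_real_derivative f x) (at x)" and cont: "continuous_on UNIV f"
    and nonneg: "\<And>x. x < 0 \<Longrightarrow> 0 \<le> f x" and lim: "(F \<longlongrightarrow> L) at_bot"
  shows "set_integrable lborel {..<0} f"
proof -
  have e: "einterval (-\<infinity>) 0 = {..<0}" by (auto simp: einterval_def)
  have "set_integrable lborel (einterval (-\<infinity>) 0) f"
  proof (rule interval_integral_FTC_nonneg(1)[where F=F and A=L and B="F 0"])
    show "isCont f x" for x using cont by (simp add: continuous_on_eq_continuous_at)
    show "((F \<circ> real_of_ereal) \<longlongrightarrow> L) (at_right (-\<infinity>))"
      using lim by (simp add: ereal_tendsto_simps)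
    have "isCont F 0" using F by (rule DERIV_isCont)
    then have "(F \<longlongrightarrow> F 0) (at_left 0)" by (simp add: filterlim_at_split isCont_def)
    then show "((F \<circ> real_of_ereal) \<longlongrightarrow> F 0) (at_left 0)"
      by (simp add: ereal_tendsto_simps zero_ereal_def)
  qed (use F nonneg in \<open>auto simp: zero_ereal_def\<close>)
  then show ?thesis unfolding e .
qed

text \<open>Integrability is a separate assumption because the integrands of interest have no fixed
  sign: it is collected from their summands, and the value then comes from the limit of the full
  primitive.\<close>

lemma has_integral_FTC_at_bot:
  fixes f F :: "real \<Rightarrow> real"
  assumes F: "\<And>x. (F has_real_derivative f x) (at x)" and cont: "continuous_on UNIV f"
    and int: "set_integrable lborel {..<0} f" and lim: "(F \<longlongrightarrow> L) at_bot"
  shows "(f has_integral F 0 - L) {..0}"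
proof -
  have e: "einterval (-\<infinity>) 0 = {..<0}" by (auto simp: einterval_def)
  have "(LBINT x=-\<infinity>..0. f x) = F 0 - L"
  proof (rule interval_integral_FTC_integrable)
    show "isCont f x" for x using cont by (simp add: continuous_on_eq_continuous_at)
    show "(F has_vector_derivative f x) (at x)" for x
      using F by (simp add: has_real_derivative_iff_has_vector_derivative)
    show "((F \<circ> real_of_ereal) \<longlongrightarrow> L) (at_right (-\<infinity>))"
      using lim by (simp add: ereal_tendsto_simps)
    have "isCont F 0" using F by (rule DERIV_isCont)
    then have "(F \<longlongrightarrow> F 0) (at_left 0)" by (simp add: filterlim_at_split isCont_def)
    then show "((F \<circ> real_of_ereal) \<longlongrightarrow> F 0) (at_left 0)"
      by (simp add: ereal_tendsto_simps zero_ereal_def)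
  qed (use int e in auto)
  then have "(LINT x:{..<0}|lborel. f x) = F 0 - L"
    by (simp add: interval_lebesgue_integral_def e)
  then have "(f has_integral F 0 - L) {..<0}"
    using set_borel_integral_eq_integral[OF int] by (simp add: has_integral_integral)
  moreover have "(f has_integral F 0 - L) {..<0} \<longleftrightarrow> (f has_integral F 0 - L) {..0}"
  proof (rule has_integral_spike_set_eq)
    show "negligible {x \<in> {..<0} - {..0}. f x \<noteq> 0}" by (rule negligible_subset[of "{0}"]) auto
    show "negligible {x \<in> {..0} - {..<0}. f x \<noteq> 0}" by (rule negligible_subset[of "{0}"]) auto
  qed
  ultimately show ?thesis by simp
qed

lemma set_integrable_exp: "c > 0 \<Longrightarrow> set_integrable lborel {..<0::real} (\<lambda>s. exp (c * s))"
proof (rule set_integrable_FTC_at_bot[where F="\<lambda>s. exp (c * s) / c" and L="0 / c"])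
  assume "c > 0"
  then show "((\<lambda>s. exp (c * s) / c) \<longlongrightarrow> 0 / c) at_bot"
    by (intro tendsto_intros exp_mult_at_bot) auto
qed (auto intro!: derivative_eq_intros continuous_intros)

lemma continuous_expint: "continuous_on UNIV (expint b)"
  by (auto intro!: continuous_at_imp_continuous_on DERIV_isCont[OF expint_deriv])

lemma set_integrable_expint:
  assumes "c > 0" "c + b > 0"
  shows "set_integrable lborel {..<0::real} (\<lambda>s. expint b s * exp (c * s))"
proof -
  have "set_integrable lborel {..<0::real} (\<lambda>s. - (expint b s * exp (c * s)))"
  proof (rule set_integrable_FTC_at_bot[where F="\<lambda>s. - expint_prim b c s" and L="- 0"])
    show "((\<lambda>s. - expint_prim b c s) \<longlongrightarrow> - 0) at_bot"
      using assms by (intro tendsto_intros expint_prim_at_bot)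
    show "((\<lambda>s. - expint_prim b c s) has_real_derivative - (expint b x * exp (c * x))) (at x)" for x
      using assms by (intro DERIV_minus expint_prim_deriv) auto
    show "0 \<le> - (expint b x * exp (c * x))" if "x < 0" for x
      using expint_nonpos[of x b] that by (simp add: mult_nonpos_nonneg)
  qed (intro continuous_intros continuous_expint)
  then show ?thesis by (simp add: set_integrable_def)
qed

text \<open>This and the next two identities extract the factor m, which will be 2 \<beta>1 -
  \<beta>2, from differences of reciprocals of rates, so that it can cancel the denominator of
  \<open>forced_coeff\<close>.\<close>

lemma partial_fractions_1:
  fixes p :: real
  assumes "p \<noteq> 0" "p + m \<noteq> 0"
  shows "1 / p - 1 / (p + m) = m * (1 / ((p + m) * p))"
  using assms by (simp add: divide_simps)

lemma partial_fractions_2: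
  fixes p b m :: real
  assumes "p \<noteq> 0" "p + b \<noteq> 0" "p + m \<noteq> 0" "p + m + b \<noteq> 0"
  shows "1 / (p * (p + b)) - 1 / ((p + m) * (p + m + b)) =
    m * (1 / ((p + m) * p * (p + b)) + 1 / ((p + m) * (p + m + b) * (p + b)))"
proof -
  \<comment> \<open>Naming the four factors keeps them atomic while denominators are cleared; what
    remains is \<open>r * s - p * q = m * (s + p)\<close>.\<close>
  have "1 / (p * q) - 1 / (r * s) = m * (1 / (r * p * q) + 1 / (r * s * q))"
    if "p \<noteq> 0" "q \<noteq> 0" "r \<noteq> 0" "s \<noteq> 0" "r = p + m" "s = q + m" for q r s
  proof -
    have "1 / (p * q) - 1 / (r * s) = (r * s - p * q) / (p * q * r * s)"
      "m * (1 / (r * p * q) + 1 / (r * s * q)) = m * (s + p) / (p * q * r * s)"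
      using that(1-4) by (simp_all add: divide_simps)
    moreover have "r * s - p * q = m * (s + p)" using that(5,6) by algebra
    ultimately show ?thesis by simp
  qed
  from this[of "p + b" "p + m" "p + m + b"] show ?thesis using assms by simp
qed

text \<open>A second difference of the reciprocal with step m, hence the factor
  \<open>m\<^sup>2\<close>; it matches the square of \<open>forced_coeff\<close> in the component
  along \<open>e 4\<close>.\<close>

lemma partial_fractions_3:
  fixes p m :: real
  assumes "p \<noteq> 0" "p + m \<noteq> 0" "p + 2 * m \<noteq> 0"
  shows "1 / p - 2 * (1 / (p + m)) + 1 / (p + 2 * m) = 2 * m\<^sup>2 * (1 / ((p + 2 * m) * (p + m) * p))"
proof -
  have "1 / p - 2 * (1 / r) + 1 / s = 2 * m\<^sup>2 * (1 / (s * r * p))"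
    if "p \<noteq> 0" "r \<noteq> 0" "s \<noteq> 0" "r = p + m" "s = p + 2 * m" for r s
  proof -
    have "1 / p - 2 * (1 / r) + 1 / s = (r * s - 2 * p * s + p * r) / (s * r * p)"
      using that(1-3) by (simp add: divide_simps) (simp add: algebra_simps)
    moreover have "r * s - 2 * p * s + p * r = 2 * m\<^sup>2" using that(4,5) by algebra
    ultimately show ?thesis by simp
  qed
  from this[of "p + m" "p + 2 * m"] show ?thesis using assms by simp
qed

section \<open>Explicit solution of the two-layer system\<close>

locale burgers =
  fixes \<nu> lam \<gamma> l :: real
  assumes \<nu>: "\<nu> > 0" and lam: "lam > 0" and l: "l > 0"
begin

abbreviation e :: "nat \<Rightarrow> ltwo" where "e \<equiv> eigvec l"
abbreviation \<beta> :: "nat \<Rightarrow> real" where "\<beta> \<equiv> eigval \<nu> lam l"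

definition \<alpha> :: real where "\<alpha> = \<gamma> * pi / (sqrt 2 * l powr (3 / 2))"

text \<open>With k = \<nu> \<pi>^2 / l^2 each combination is a positive multiple of
  \<open>lam\<close> plus a nonnegative multiple of k. Two of them are written with
  \<open>\<beta> 2\<close> added last, the form c + b in which the lemmas on
  \<open>expint_prim\<close> use them.\<close>

lemma nonresonance:
  "2 * \<beta> 1 - \<beta> 2 > 0" "\<beta> 1 + \<beta> 2 - \<beta> 3 > 0" "\<beta> 1 + \<beta> 2 - \<beta> 3 + \<beta> 2 > 0"
  "3 * \<beta> 1 - \<beta> 3 > 0" "3 * \<beta> 1 - \<beta> 3 + \<beta> 2 > 0"
  "2 * \<beta> 1 + \<beta> 2 - \<beta> 4 > 0" "4 * \<beta> 1 - \<beta> 4 > 0" "2 * \<beta> 2 - \<beta> 4 > 0"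
proof -
  define k where "k = \<nu> * pi\<^sup>2 / l\<^sup>2"
  have "k > 0" using \<nu> l by (simp add: k_def)
  moreover have "\<beta> n = lam - (real n)\<^sup>2 * k" for n
    by (simp add: eigval_def k_def)
  ultimately show
    "2 * \<beta> 1 - \<beta> 2 > 0" "\<beta> 1 + \<beta> 2 - \<beta> 3 > 0" "\<beta> 1 + \<beta> 2 - \<beta> 3 + \<beta> 2 > 0"
    "3 * \<beta> 1 - \<beta> 3 > 0" "3 * \<beta> 1 - \<beta> 3 + \<beta> 2 > 0"
    "2 * \<beta> 1 + \<beta> 2 - \<beta> 4 > 0" "4 * \<beta> 1 - \<beta> 4 > 0" "2 * \<beta> 2 - \<beta> 4 > 0"
    using lam by simp_all
qed

definition yc1_sol :: "real \<Rightarrow> real \<Rightarrow> real \<Rightarrow> ltwo" where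
  "yc1_sol x1 x2 s = (x1 * exp (\<beta> 1 * s)) *\<^sub>R e 1 + (x2 * exp (\<beta> 2 * s)) *\<^sub>R e 2"

text \<open>Variation of constants: relative to the free mode of rate \<beta>1, the forcing of rate
  \<beta>1 + \<beta>2 leaves an exponential of rate \<beta>2 to integrate. The second coefficient
  below arises likewise, where the rate left over is 2 \<beta>1 - \<beta>2, which is
  nonzero.\<close>

definition yc2_coeff1 :: "real \<Rightarrow> real \<Rightarrow> real \<Rightarrow> real" where
  "yc2_coeff1 x1 x2 s = exp (\<beta> 1 * s) * (x1 + \<alpha> * x1 * x2 * expint (\<beta> 2) s)"

definition yc2_coeff2 :: "real \<Rightarrow> real \<Rightarrow> real \<Rightarrow> real" where
  "yc2_coeff2 x1 x2 s = x2 * exp (\<beta> 2 * s) - \<alpha> * x1\<^sup>2 * (exp (2 * \<beta> 1 * s) - exp (\<beta> 2 * s)) / (2 * \<beta> 1 - \<beta> 2)"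

definition yc2_sol :: "real \<Rightarrow> real \<Rightarrow> real \<Rightarrow> ltwo" where
  "yc2_sol x1 x2 s = yc2_coeff1 x1 x2 s *\<^sub>R e 1 + yc2_coeff2 x1 x2 s *\<^sub>R e 2"

lemma Lc_pair: "Lc \<nu> lam l (a *\<^sub>R e 1 + b *\<^sub>R e 2) = (\<beta> 1 * a) *\<^sub>R e 1 + (\<beta> 2 * b) *\<^sub>R e 2"
  by (rule Lc_eq[OF l])

lemma Bop_pair: "Bop \<gamma> l (a *\<^sub>R e 1 + b *\<^sub>R e 2) (a *\<^sub>R e 1 + b *\<^sub>R e 2) =
    ((\<alpha> * a * b) *\<^sub>R e 1 + (- \<alpha> * a\<^sup>2) *\<^sub>R e 2) + ((- 3 * \<alpha> * a * b) *\<^sub>R e 3 + (- 2 * \<alpha> * b\<^sup>2) *\<^sub>R e 4)"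
  by (rule Bop_Hc[OF l]) (simp add: \<alpha>_def)

lemma Pc_Bop: "Pc l (Bop \<gamma> l (a *\<^sub>R e 1 + b *\<^sub>R e 2) (a *\<^sub>R e 1 + b *\<^sub>R e 2)) =
    (\<alpha> * a * b) *\<^sub>R e 1 + (- \<alpha> * a\<^sup>2) *\<^sub>R e 2"
  unfolding Bop_pair Pc_eq[OF l] by (simp add: inner_add_left inner_diff_left inner_eigvec[OF l])

lemma Ps_Bop: "Ps l (Bop \<gamma> l (a *\<^sub>R e 1 + b *\<^sub>R e 2) (a *\<^sub>R e 1 + b *\<^sub>R e 2)) =
    (- 3 * \<alpha> * a * b) *\<^sub>R e 3 + (- 2 * \<alpha> * b\<^sup>2) *\<^sub>R e 4"
proof -
  have "Bop \<gamma> l (a *\<^sub>R e 1 + b *\<^sub>R e 2) (a *\<^sub>R e 1 + b *\<^sub>R e 2) \<in> L2_on l"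
    unfolding Bop_pair by (intro subspace_add subspace_scale subspace_L2_on eigvec_L2 l)
  then show ?thesis
    by (simp only: Ps_eq[OF l] Pc_Bop) (simp only: Bop_pair add_diff_cancel_left')
qed

lemma yc1_sol_deriv: "(yc1_sol x1 x2 has_vector_derivative Lc \<nu> lam l (yc1_sol x1 x2 s)) (at s within I)"
  unfolding yc1_sol_def[abs_def] Lc_pair
  by (rule has_vector_derivative_at_within, rule has_vector_derivative_pair)
    (auto intro!: derivative_eq_intros)

lemma yc2_coeff1_deriv: "(yc2_coeff1 x1 x2 has_real_derivative
    \<beta> 1 * yc2_coeff1 x1 x2 s + \<alpha> * (x1 * exp (\<beta> 1 * s)) * (x2 * exp (\<beta> 2 * s))) (at s)"
  unfolding yc2_coeff1_def[abs_def]
  by (auto intro!: derivative_eq_intros expint_deriv simp: algebra_simps)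

text \<open>Up to sign, the coefficient of the mode $e^{2 \beta_1 s}$ that the forcing creates in \<open>yc2_coeff2\<close>.\<close>

definition forced_coeff :: "real \<Rightarrow> real" where "forced_coeff x1 = \<alpha> * x1\<^sup>2 / (2 * \<beta> 1 - \<beta> 2)"

lemma yc2_coeff2_eq: "yc2_coeff2 x1 x2 s = (x2 + forced_coeff x1) * exp (\<beta> 2 * s) - forced_coeff x1 * exp (2 * \<beta> 1 * s)"
  unfolding yc2_coeff2_def forced_coeff_def by (simp add: algebra_simps diff_divide_distrib)

lemma forced_coeff_mult: "forced_coeff x1 * (2 * \<beta> 1 - \<beta> 2) = \<alpha> * x1\<^sup>2"
  using nonresonance(1) by (simp add: forced_coeff_def)

lemma yc2_coeff2_deriv: "(yc2_coeff2 x1 x2 has_real_derivative \<beta> 2 * yc2_coeff2 x1 x2 s + - \<alpha> * (x1 * exp (\<beta> 1 * s))\<^sup>2) (at s)"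
proof -
  have "(yc2_coeff2 x1 x2 has_real_derivative (x2 + forced_coeff x1) * (exp (\<beta> 2 * s) * \<beta> 2) - forced_coeff x1 * (exp (2 * \<beta> 1 * s) * (2 * \<beta> 1))) (at s)"
    unfolding yc2_coeff2_eq[abs_def] by (auto intro!: derivative_eq_intros)
  moreover have "exp (2 * \<beta> 1 * s) = (exp (\<beta> 1 * s))\<^sup>2"
    by (simp add: power2_eq_square flip: exp_add)
  then have "(x2 + forced_coeff x1) * (exp (\<beta> 2 * s) * \<beta> 2) - forced_coeff x1 * (exp (2 * \<beta> 1 * s) * (2 * \<beta> 1))
      = \<beta> 2 * yc2_coeff2 x1 x2 s + - \<alpha> * (x1 * exp (\<beta> 1 * s))\<^sup>2"
    unfolding yc2_coeff2_eq using forced_coeff_mult[of x1] by algebra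
  ultimately show ?thesis by simp
qed

lemma yc2_sol_deriv: "(yc2_sol x1 x2 has_vector_derivative
    Lc \<nu> lam l (yc2_sol x1 x2 s) + Pc l (Bop \<gamma> l (yc1_sol x1 x2 s) (yc1_sol x1 x2 s))) (at s within I)"
proof -
  have "(yc2_sol x1 x2 has_vector_derivative
     (\<beta> 1 * yc2_coeff1 x1 x2 s + \<alpha> * (x1 * exp (\<beta> 1 * s)) * (x2 * exp (\<beta> 2 * s))) *\<^sub>R e 1 +
     (\<beta> 2 * yc2_coeff2 x1 x2 s + - \<alpha> * (x1 * exp (\<beta> 1 * s))\<^sup>2) *\<^sub>R e 2) (at s)"
    unfolding yc2_sol_def[abs_def] by (intro has_vector_derivative_pair yc2_coeff1_deriv yc2_coeff2_deriv)
  moreover have "(\<beta> 1 * yc2_coeff1 x1 x2 s + \<alpha> * (x1 * exp (\<beta> 1 * s)) * (x2 * exp (\<beta> 2 * s))) *\<^sub>R e 1 +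
     (\<beta> 2 * yc2_coeff2 x1 x2 s + - \<alpha> * (x1 * exp (\<beta> 1 * s))\<^sup>2) *\<^sub>R e 2
     = Lc \<nu> lam l (yc2_sol x1 x2 s) + Pc l (Bop \<gamma> l (yc1_sol x1 x2 s) (yc1_sol x1 x2 s))"
    unfolding yc2_sol_def yc1_sol_def Lc_pair Pc_Bop scaleR_add_left by (simp only: ac_simps)
  ultimately show ?thesis by (simp add: has_vector_derivative_at_within)
qed

lemma yc1_sol_Hc: "yc1_sol x1 x2 s \<in> Hc l" and yc2_sol_Hc: "yc2_sol x1 x2 s \<in> Hc l"
  unfolding yc1_sol_def yc2_sol_def by (rule Hc_lincomb)+

text \<open>The set I is arbitrary because the same pair of curves serves on the bounded interval of
  the full system and on the half-line used by \<open>yc2\<close>.\<close>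

lemma backward_layers_Y:
  "backward_layers \<nu> lam \<gamma> l (x1 *\<^sub>R e 1 + x2 *\<^sub>R e 2) I (yc1_sol x1 x2) (yc2_sol x1 x2)"
  unfolding backward_layers_def
  by (intro conjI ballI yc1_sol_deriv yc2_sol_deriv yc1_sol_Hc yc2_sol_Hc) (simp_all add: yc1_sol_def yc2_sol_def yc2_coeff1_def yc2_coeff2_def)

section \<open>Uniqueness for the backward and the stable equations\<close>

lemma backward_unique_Hc:
  assumes s: "s \<le> 0"
    and y: "\<And>t. t \<in> {s..0} \<Longrightarrow> y t \<in> Hc l \<and> (y has_vector_derivative Lc \<nu> lam l (y t) + g t) (at t within {s..0})"
    and z: "\<And>t. t \<in> {s..0} \<Longrightarrow> z t \<in> Hc l \<and> (z has_vector_derivative Lc \<nu> lam l (z t) + g t) (at t within {s..0})"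
    and 0: "y 0 = z 0"
  shows "y s = z s"
proof -
  let ?d = "\<lambda>t. y t - z t" and ?w = "\<lambda>t. y (- t) - z (- t)"
  let ?D = "\<lambda>t. Lc \<nu> lam l (y t) - Lc \<nu> lam l (z t)"
  have d: "(?d has_vector_derivative ?D t) (at t within {s..0})" if "t \<in> {s..0}" for t
    using has_vector_derivative_diff[OF conjunct2[OF y[OF that]] conjunct2[OF z[OF that]]] by simp
  have "?w (- s) = 0"
  \<comment> \<open>The energy estimate runs forward, so time is reversed. The operator is diagonal
    on the plane, and the sum of the absolute eigenvalues bounds it with either sign; the forcing g
    has dropped out of the difference.\<close>
  proof (rule energy_zero[where w="?w" and D="\<lambda>t. - ?D (- t)" and C="\<bar>\<beta> 1\<bar> + \<bar>\<beta> 2\<bar>"])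
    have "continuous_on {s..0} ?d"
      using d by (rule continuous_on_vector_derivative)
    then show "continuous_on {0..- s} ?w"
      by (rule continuous_on_compose2[where f=uminus]) (auto intro: continuous_intros)
  next
    fix t assume t: "0 < t" "t < - s"
    then have "(?d has_vector_derivative ?D (- t)) (at (- t))"
      using d[of "- t"] by (simp add: at_within_Icc_at)
    moreover have "(uminus has_vector_derivative (- 1)) (at t)"
      by (auto intro!: derivative_eq_intros)
    ultimately show "(?w has_vector_derivative - ?D (- t)) (at t)"
      using vector_diff_chain_at[of uminus "- 1" t ?d "?D (- t)"] by (simp add: o_def)
    have "- t \<in> {s..0}" using t by simp
    then obtain a b c d where yz: "y (- t) = a *\<^sub>R e 1 + b *\<^sub>R e 2" "z (- t) = c *\<^sub>R e 1 + d *\<^sub>R e 2"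
      using y[of "- t"] z[of "- t"] by (metis Hc_cases)
    have w: "?w t = (a - c) *\<^sub>R e 1 + (b - d) *\<^sub>R e 2"
      and D: "?D (- t) = (\<beta> 1 * (a - c)) *\<^sub>R e 1 + (\<beta> 2 * (b - d)) *\<^sub>R e 2"
      unfolding yz Lc_pair by (simp_all add: algebra_simps)
    have "inner (?w t) (- ?D (- t)) = - \<beta> 1 * (a - c)\<^sup>2 + - \<beta> 2 * (b - d)\<^sup>2"
      unfolding w D inner_minus_right
      by (simp add: inner_add_left inner_add_right inner_eigvec[OF l] power2_eq_square)
    also have "\<dots> \<le> (\<bar>\<beta> 1\<bar> + \<bar>\<beta> 2\<bar>) * (a - c)\<^sup>2 + (\<bar>\<beta> 1\<bar> + \<bar>\<beta> 2\<bar>) * (b - d)\<^sup>2"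
      by (intro add_mono mult_right_mono) auto
    also have "\<dots> = (\<bar>\<beta> 1\<bar> + \<bar>\<beta> 2\<bar>) * (norm (?w t))\<^sup>2"
      unfolding w by (simp add: orthonormal_pair_norm[OF l] distrib_left del: One_nat_def)
    finally show "inner (?w t) (- ?D (- t)) \<le> (\<bar>\<beta> 1\<bar> + \<bar>\<beta> 2\<bar>) * (norm (?w t))\<^sup>2" .
  qed (use s 0 in auto)
  then show ?thesis by simp
qed

lemma backward_layers_unique:
  assumes sys: "backward_layers \<nu> lam \<gamma> l (x1 *\<^sub>R e 1 + x2 *\<^sub>R e 2) I y1 y2"
    and s: "s \<le> 0" "{s..0} \<subseteq> I"
  shows "y1 s = yc1_sol x1 x2 s" "y2 s = yc2_sol x1 x2 s"
proof -
  note Y = backward_layers_Y[of x1 x2 I]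
  \<comment> \<open>The first layer is identified on the whole interval, since it enters the forcing
    of the second, which thereby becomes a given function of time.\<close>
  have 1: "y1 t = yc1_sol x1 x2 t" if t: "s \<le> t" "t \<le> 0" for t
  proof (rule backward_unique_Hc[where g="\<lambda>_. 0"])
    have sub: "{t..0} \<subseteq> I" using s t by auto
    fix r assume r: "r \<in> {t..0}"
    then have "y1 r \<in> Hc l" "(y1 has_vector_derivative Lc \<nu> lam l (y1 r) + 0) (at r within I)"
      using sys sub unfolding backward_layers_def by auto
    then show "y1 r \<in> Hc l \<and> (y1 has_vector_derivative Lc \<nu> lam l (y1 r) + 0) (at r within {t..0})"
      by (auto intro: has_vector_derivative_within_subset[OF _ sub])
    show "yc1_sol x1 x2 r \<in> Hc l \<and> (yc1_sol x1 x2 has_vector_derivative Lc \<nu> lam l (yc1_sol x1 x2 r) + 0) (at r within {t..0})"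
      using yc1_sol_Hc yc1_sol_deriv by simp
  next
    show "y1 0 = yc1_sol x1 x2 0" using sys Y by (simp add: backward_layers_def)
  qed (rule t)
  then show "y1 s = yc1_sol x1 x2 s" using s by simp
  show "y2 s = yc2_sol x1 x2 s"
  proof (rule backward_unique_Hc[where g="\<lambda>t. Pc l (Bop \<gamma> l (yc1_sol x1 x2 t) (yc1_sol x1 x2 t))"])
    fix r assume r: "r \<in> {s..0}"
    then have eq: "y1 r = yc1_sol x1 x2 r" using 1 by simp
    have "y2 r \<in> Hc l" "(y2 has_vector_derivative Lc \<nu> lam l (y2 r) + Pc l (Bop \<gamma> l (y1 r) (y1 r))) (at r within I)"
      using sys s r unfolding backward_layers_def by auto
    then show "y2 r \<in> Hc l \<and> (y2 has_vector_derivative Lc \<nu> lam l (y2 r) + Pc l (Bop \<gamma> l (yc1_sol x1 x2 r) (yc1_sol x1 x2 r))) (at r within {s..0})"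
      unfolding eq by (auto intro: has_vector_derivative_within_subset[OF _ s(2)])
    show "yc2_sol x1 x2 r \<in> Hc l \<and> (yc2_sol x1 x2 has_vector_derivative Lc \<nu> lam l (yc2_sol x1 x2 r) + Pc l (Bop \<gamma> l (yc1_sol x1 x2 r) (yc1_sol x1 x2 r))) (at r within {s..0})"
      using yc2_sol_Hc yc2_sol_deriv by blast
  next
    show "y2 0 = yc2_sol x1 x2 0" using sys Y by (simp add: backward_layers_def)
  qed (rule s)
qed

lemma yc2_eq:
  assumes "s \<le> 0"
  shows "yc2 \<nu> lam \<gamma> l (x1 *\<^sub>R e 1 + x2 *\<^sub>R e 2) s = yc2_sol x1 x2 s"
  unfolding yc2_def
proof (rule the_equality)
  show "\<exists>y1 y2. backward_layers \<nu> lam \<gamma> l (x1 *\<^sub>R e 1 + x2 *\<^sub>R e 2) {..0} y1 y2 \<and> yc2_sol x1 x2 s = y2 s"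
    using backward_layers_Y by blast
  show "v = yc2_sol x1 x2 s"
    if "\<exists>y1 y2. backward_layers \<nu> lam \<gamma> l (x1 *\<^sub>R e 1 + x2 *\<^sub>R e 2) {..0} y1 y2 \<and> v = y2 s" for v
    using that backward_layers_unique(2)[of x1 x2 "{..0}" _ _ s] assms by auto
qed

text \<open>The difference of two solutions solves the homogeneous equation and stays in the domain,
  where \<open>inner_Ls_le\<close> gives the energy estimate with constant
  \<open>lam\<close>.\<close>

lemma stable_unique:
  assumes ab: "a \<le> b"
    and cont: "continuous_on {a..b} y" "continuous_on {a..b} z"
    and y: "\<And>t. a < t \<Longrightarrow> t < b \<Longrightarrow> y t \<in> Ldom l \<inter> Hs l \<and> (y has_vector_derivative Ls \<nu> lam l (y t) + g t) (at t)"
    and z: "\<And>t. a < t \<Longrightarrow> t < b \<Longrightarrow> z t \<in> Ldom l \<inter> Hs l \<and> (z has_vector_derivative Ls \<nu> lam l (z t) + g t) (at t)"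
    and 0: "y a = z a"
  shows "y b = z b"
proof -
  have "y b - z b = 0"
  proof (rule energy_zero[OF ab, where w="\<lambda>t. y t - z t" and D="\<lambda>t. Ls \<nu> lam l (y t - z t)" and C=lam])
    fix t assume t: "a < t" "t < b"
    note yt = y[OF t] and zt = z[OF t]
    have eq: "Ls \<nu> lam l (y t - z t) = Ls \<nu> lam l (y t) - Ls \<nu> lam l (z t)"
      using Ls_lincomb[OF l, of "y t" "z t" \<nu> lam 1 "-1"] yt zt by simp
    show "((\<lambda>t. y t - z t) has_vector_derivative Ls \<nu> lam l (y t - z t)) (at t)"
      unfolding eq using has_vector_derivative_diff[OF conjunct2[OF yt] conjunct2[OF zt]] by simp
    have "y t - z t \<in> Ldom l \<inter> Hs l"
      using Ldom_lincomb(1)[OF l, of "y t" "z t" 1 "-1"] Hs_lincomb[of "y t" l "z t" 1 "-1"] yt zt by simp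
    then show "inner (y t - z t) (Ls \<nu> lam l (y t - z t)) \<le> lam * (norm (y t - z t))\<^sup>2"
      using \<nu> by (intro inner_Ls_le l) auto
  qed (use 0 cont in \<open>auto intro!: continuous_intros\<close>)
  then show ?thesis by simp
qed

lemma stable_pair_mem: "a *\<^sub>R e 3 + b *\<^sub>R e 4 \<in> Ldom l \<inter> Hs l"
  using l by (simp add: Ldom_lincomb(1) eigvec_Ldom(1) Hs_lincomb eigvec_Hs)

lemma Ls_pair: "Ls \<nu> lam l (a *\<^sub>R e 3 + b *\<^sub>R e 4) = (\<beta> 3 * a) *\<^sub>R e 3 + (\<beta> 4 * b) *\<^sub>R e 4"
  using l by (simp add: Ls_lincomb eigvec_Ldom(1) Ls_eigvec mult.commute)

text \<open>The explicit diagonal curve is a classical solution, and \<open>stable_unique\<close>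
  with zero forcing excludes any other value at time t.\<close>

lemma exp_Ls_pair:
  assumes "t \<ge> 0"
  shows "exp_Ls \<nu> lam l t (a *\<^sub>R e 3 + b *\<^sub>R e 4) = (a * exp (\<beta> 3 * t)) *\<^sub>R e 3 + (b * exp (\<beta> 4 * t)) *\<^sub>R e 4"
  unfolding exp_Ls_def semigroup_op_def
proof (rule the_equality)
  let ?u = "\<lambda>t. (a * exp (\<beta> 3 * t)) *\<^sub>R e 3 + (b * exp (\<beta> 4 * t)) *\<^sub>R e 4"
  have u': "(?u has_vector_derivative Ls \<nu> lam l (?u s)) (at s)" for s
    unfolding Ls_pair by (rule has_vector_derivative_pair) (auto intro!: derivative_eq_intros)
  have cu: "continuous_on A ?u" for A by (intro continuous_intros)
  then show "\<exists>u. u 0 = a *\<^sub>R e 3 + b *\<^sub>R e 4 \<and> continuous_on {0..} u \<and>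
      (\<forall>s>0. u s \<in> Ldom l \<inter> Hs l \<and> (u has_vector_derivative Ls \<nu> lam l (u s)) (at s)) \<and> ?u t = u t"
    using u' stable_pair_mem by (intro exI[of _ ?u]) simp
  fix v assume "\<exists>u. u 0 = a *\<^sub>R e 3 + b *\<^sub>R e 4 \<and> continuous_on {0..} u \<and>
      (\<forall>s>0. u s \<in> Ldom l \<inter> Hs l \<and> (u has_vector_derivative Ls \<nu> lam l (u s)) (at s)) \<and> v = u t"
  then obtain u where u: "u 0 = ?u 0" "continuous_on {0..} u" "v = u t"
    "\<And>s. s > 0 \<Longrightarrow> u s \<in> Ldom l \<inter> Hs l \<and> (u has_vector_derivative Ls \<nu> lam l (u s)) (at s)"
    by auto
  have "u t = ?u t"
    by (rule stable_unique[where a=0 and g="\<lambda>_. 0"])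
      (use u u' cu stable_pair_mem assms in \<open>auto intro: continuous_on_subset\<close>)
  then show "v = ?u t" using u by simp
qed

text \<open>Plays a double role, as does its companion for \<open>e 4\<close>: it is the derivative
  of the stable coefficient after multiplication by the integrating factor, and it is the coordinate
  of \<open>pullback_integrand\<close>.\<close>

definition h3_integrand :: "real \<Rightarrow> real \<Rightarrow> real \<Rightarrow> real" where
  "h3_integrand x1 x2 s = exp (- \<beta> 3 * s) * (- 3 * \<alpha> * yc2_coeff1 x1 x2 s * yc2_coeff2 x1 x2 s)"

definition h4_integrand :: "real \<Rightarrow> real \<Rightarrow> real \<Rightarrow> real" where
  "h4_integrand x1 x2 s = exp (- \<beta> 4 * s) * (- 2 * \<alpha> * (yc2_coeff2 x1 x2 s)\<^sup>2)"

text \<open>The second coefficient has modes of rates \<beta>2 and 2 \<beta>1. Multiplied by the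
  mode of rate \<beta>1 and by the integrating factor of \<open>e 3\<close>, they leave the rates
  \<sigma> and \<rho>, which differ by 2 \<beta>1 - \<beta>2.\<close>

abbreviation \<sigma> where "\<sigma> \<equiv> \<beta> 1 + \<beta> 2 - \<beta> 3"
abbreviation \<rho> where "\<rho> \<equiv> 3 * \<beta> 1 - \<beta> 3"

definition h3_prim :: "real \<Rightarrow> real \<Rightarrow> real \<Rightarrow> real" where
  "h3_prim x1 x2 s = - 3 * \<alpha> * (x1 * (x2 + forced_coeff x1) * (exp (\<sigma> * s) / \<sigma>) - x1 * forced_coeff x1 * (exp (\<rho> * s) / \<rho>)
     + \<alpha> * x1 * x2 * (x2 + forced_coeff x1) * expint_prim (\<beta> 2) \<sigma> s - \<alpha> * x1 * x2 * forced_coeff x1 * expint_prim (\<beta> 2) \<rho> s)"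

definition h4_prim :: "real \<Rightarrow> real \<Rightarrow> real \<Rightarrow> real" where
  "h4_prim x1 x2 s = - 2 * \<alpha> * ((x2 + forced_coeff x1)\<^sup>2 * (exp ((2 * \<beta> 2 - \<beta> 4) * s) / (2 * \<beta> 2 - \<beta> 4))
     - 2 * (x2 + forced_coeff x1) * forced_coeff x1 * (exp ((2 * \<beta> 1 + \<beta> 2 - \<beta> 4) * s) / (2 * \<beta> 1 + \<beta> 2 - \<beta> 4))
     + (forced_coeff x1)\<^sup>2 * (exp ((4 * \<beta> 1 - \<beta> 4) * s) / (4 * \<beta> 1 - \<beta> 4)))"

lemma h3_integrand_eq: "h3_integrand x1 x2 s = - 3 * \<alpha> * (x1 * (x2 + forced_coeff x1) * exp (\<sigma> * s) - x1 * forced_coeff x1 * exp (\<rho> * s)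
     + \<alpha> * x1 * x2 * (x2 + forced_coeff x1) * (expint (\<beta> 2) s * exp (\<sigma> * s))
     - \<alpha> * x1 * x2 * forced_coeff x1 * (expint (\<beta> 2) s * exp (\<rho> * s)))"
proof -
  have \<sigma>: "exp (\<sigma> * s) = exp (- \<beta> 3 * s) * exp (\<beta> 1 * s) * exp (\<beta> 2 * s)"
    and \<rho>: "exp (\<rho> * s) = exp (- \<beta> 3 * s) * exp (\<beta> 1 * s) * exp (2 * \<beta> 1 * s)"
    by (simp_all add: algebra_simps flip: exp_add)
  show ?thesis unfolding h3_integrand_def yc2_coeff1_def yc2_coeff2_eq \<sigma> \<rho> by algebra
qed

lemma h4_integrand_eq: "h4_integrand x1 x2 s = - 2 * \<alpha> * ((x2 + forced_coeff x1)\<^sup>2 * exp ((2 * \<beta> 2 - \<beta> 4) * s)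
     - 2 * (x2 + forced_coeff x1) * forced_coeff x1 * exp ((2 * \<beta> 1 + \<beta> 2 - \<beta> 4) * s)
     + (forced_coeff x1)\<^sup>2 * exp ((4 * \<beta> 1 - \<beta> 4) * s))"
proof -
  have *: "exp ((2 * \<beta> 2 - \<beta> 4) * s) = exp (- \<beta> 4 * s) * exp (\<beta> 2 * s) * exp (\<beta> 2 * s)"
    "exp ((2 * \<beta> 1 + \<beta> 2 - \<beta> 4) * s) = exp (- \<beta> 4 * s) * exp (\<beta> 2 * s) * exp (2 * \<beta> 1 * s)"
    "exp ((4 * \<beta> 1 - \<beta> 4) * s) = exp (- \<beta> 4 * s) * exp (2 * \<beta> 1 * s) * exp (2 * \<beta> 1 * s)"
    by (simp_all add: algebra_simps flip: exp_add)
  show ?thesis unfolding h4_integrand_def yc2_coeff2_eq * by algebra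
qed

lemma exp_prim_deriv: "(c :: real) \<noteq> 0 \<Longrightarrow> ((\<lambda>s. exp (c * s) / c) has_real_derivative exp (c * s)) (at s)"
  by (auto intro!: derivative_eq_intros)

lemma h3_prim_deriv: "(h3_prim x1 x2 has_real_derivative h3_integrand x1 x2 s) (at s)"
  unfolding h3_prim_def[abs_def] h3_integrand_eq using nonresonance
  by (intro DERIV_cmult DERIV_add DERIV_diff exp_prim_deriv expint_prim_deriv) auto

lemma h4_prim_deriv: "(h4_prim x1 x2 has_real_derivative h4_integrand x1 x2 s) (at s)"
  unfolding h4_prim_def[abs_def] h4_integrand_eq using nonresonance
  by (intro DERIV_cmult DERIV_add DERIV_diff exp_prim_deriv) auto

lemma exp_prim_at_bot: "(c :: real) > 0 \<Longrightarrow> ((\<lambda>s. exp (c * s) / c) \<longlongrightarrow> 0) at_bot"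
  using tendsto_divide[OF exp_mult_at_bot tendsto_const, of c c] by simp

lemma h3_prim_at_bot: "(h3_prim x1 x2 \<longlongrightarrow> 0) at_bot"
proof -
  have "(h3_prim x1 x2 \<longlongrightarrow> - 3 * \<alpha> * (x1 * (x2 + forced_coeff x1) * 0 - x1 * forced_coeff x1 * 0
     + \<alpha> * x1 * x2 * (x2 + forced_coeff x1) * 0 - \<alpha> * x1 * x2 * forced_coeff x1 * 0)) at_bot"
    unfolding h3_prim_def[abs_def]
    by (intro tendsto_mult tendsto_add tendsto_diff tendsto_const exp_prim_at_bot expint_prim_at_bot nonresonance)
  then show ?thesis by simp
qed

lemma h4_prim_at_bot: "(h4_prim x1 x2 \<longlongrightarrow> 0) at_bot"
proof -
  have "(h4_prim x1 x2 \<longlongrightarrow> - 2 * \<alpha> * ((x2 + forced_coeff x1)\<^sup>2 * 0 - 2 * (x2 + forced_coeff x1) * forced_coeff x1 * 0 + (forced_coeff x1)\<^sup>2 * 0)) at_bot"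
    unfolding h4_prim_def[abs_def]
    by (intro tendsto_mult tendsto_add tendsto_diff tendsto_const exp_prim_at_bot nonresonance)
  then show ?thesis by simp
qed

lemma continuous_h3_integrand: "continuous_on UNIV (h3_integrand x1 x2)" and continuous_h4_integrand: "continuous_on UNIV (h4_integrand x1 x2)"
  unfolding h3_integrand_eq[abs_def] h4_integrand_eq[abs_def] by (intro continuous_intros continuous_expint)+

lemma integrable_h3_integrand: "set_integrable lborel {..<0} (h3_integrand x1 x2)"
  unfolding h3_integrand_eq[abs_def] using nonresonance
  by (intro set_integrable_mult_right set_integral_add(1) set_integral_diff(1)
      set_integrable_exp set_integrable_expint) auto

lemma integrable_h4_integrand: "set_integrable lborel {..<0} (h4_integrand x1 x2)"
  unfolding h4_integrand_eq[abs_def] using nonresonance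
  by (intro set_integrable_mult_right set_integral_add(1) set_integral_diff(1) set_integrable_exp) auto

section \<open>The polynomial coefficients\<close>

lemma h3_prim_0: "h3_prim x1 x2 0 = - (3 * \<alpha>) / \<sigma> * x1 * x2 + - (3 * \<alpha>^2) / (\<rho> * \<sigma>) * x1^3
     + 3 * \<alpha>^2 / ((\<beta> 1 + 2 * \<beta> 2 - \<beta> 3) * \<sigma>) * x1 * x2^2
     + (3 * \<alpha>^3 / (\<rho> * \<sigma> * (\<beta> 1 + 2 * \<beta> 2 - \<beta> 3))
       + 3 * \<alpha>^3 / (\<rho> * (3 * \<beta> 1 + \<beta> 2 - \<beta> 3) * (\<beta> 1 + 2 * \<beta> 2 - \<beta> 3))) * x1^3 * x2"
proof -
  define p m where "p = \<sigma>" and "m = 2 * \<beta> 1 - \<beta> 2"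
  have eqs: "\<rho> = p + m" "\<beta> 1 + 2 * \<beta> 2 - \<beta> 3 = p + \<beta> 2" "3 * \<beta> 1 + \<beta> 2 - \<beta> 3 = p + m + \<beta> 2" "\<sigma> = p"
    "2 * \<beta> 1 - \<beta> 2 = m"
    by (simp_all add: p_def m_def)
  have nz: "m \<noteq> 0" "p \<noteq> 0" "p + \<beta> 2 \<noteq> 0" "p + m \<noteq> 0" "p + m + \<beta> 2 \<noteq> 0"
    using nonresonance unfolding p_def m_def by auto
  \<comment> \<open>With the reciprocals as atoms the claim is polynomial. The terms containing
    \<open>forced_coeff x1\<close> group into multiples of A1 - A2 and A3 - A4; their factor m turns
    \<open>forced_coeff x1\<close> into \<alpha> times the square of x1. Up to constants, A1, c1, A3
    and c2 are the four asserted coefficients.\<close>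
  define A1 A2 A3 A4 c1 c2 where "A1 = 1 / p" and "A2 = 1 / (p + m)" and "A3 = 1 / (p * (p + \<beta> 2))"
    and "A4 = 1 / ((p + m) * (p + m + \<beta> 2))" and "c1 = 1 / ((p + m) * p)"
    and "c2 = 1 / ((p + m) * p * (p + \<beta> 2)) + 1 / ((p + m) * (p + m + \<beta> 2) * (p + \<beta> 2))"
  have A: "A1 - A2 = m * c1" "A3 - A4 = m * c2"
    unfolding A1_def A2_def A3_def A4_def c1_def c2_def using nz
    by (intro partial_fractions_1 partial_fractions_2; simp)+
  have Mm: "forced_coeff x1 * m = \<alpha> * x1\<^sup>2" using forced_coeff_mult[of x1] unfolding m_def .
  have "h3_prim x1 x2 0 = - 3 * \<alpha> * (x1 * (x2 + forced_coeff x1) * A1 - x1 * forced_coeff x1 * A2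
      - \<alpha> * x1 * x2 * (x2 + forced_coeff x1) * A3 + \<alpha> * x1 * x2 * forced_coeff x1 * A4)"
    unfolding h3_prim_def expint_prim_def expint_0 mult_zero_right exp_zero unfolding eqs
      A1_def A2_def A3_def A4_def by simp
  also have "\<dots> = - (3 * \<alpha>) * A1 * x1 * x2 + - (3 * \<alpha>^2) * c1 * x1^3 + 3 * \<alpha>^2 * A3 * x1 * x2^2
      + 3 * \<alpha>^3 * c2 * x1^3 * x2"
    using A Mm by algebra
  finally show ?thesis
    unfolding eqs A1_def A3_def c1_def c2_def by (simp add: mult.commute distrib_left)
qed

lemma h4_prim_0: "h4_prim x1 x2 0 = - (2 * \<alpha>) / (2 * \<beta> 2 - \<beta> 4) * x2^2
     + - (4 * \<alpha>^2) / ((2 * \<beta> 1 + \<beta> 2 - \<beta> 4) * (2 * \<beta> 2 - \<beta> 4)) * x1^2 * x2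
     + - (4 * \<alpha>^3) / ((4 * \<beta> 1 - \<beta> 4) * (2 * \<beta> 1 + \<beta> 2 - \<beta> 4) * (2 * \<beta> 2 - \<beta> 4)) * x1^4"
proof -
  define p m where "p = 2 * \<beta> 2 - \<beta> 4" and "m = 2 * \<beta> 1 - \<beta> 2"
  have eqs: "2 * \<beta> 1 + \<beta> 2 - \<beta> 4 = p + m" "4 * \<beta> 1 - \<beta> 4 = p + 2 * m" "2 * \<beta> 2 - \<beta> 4 = p"
    "2 * \<beta> 1 - \<beta> 2 = m"
    by (simp_all add: p_def m_def)
  have nz: "m \<noteq> 0" "p \<noteq> 0" "p + m \<noteq> 0" "p + 2 * m \<noteq> 0"
    using nonresonance unfolding p_def m_def by auto
  define A1 A2 A3 c1 c2 where "A1 = 1 / p" and "A2 = 1 / (p + m)" and "A3 = 1 / (p + 2 * m)"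
    and "c1 = 1 / ((p + m) * p)" and "c2 = 1 / ((p + 2 * m) * (p + m) * p)"
  \<comment> \<open>The first and second differences multiply the terms linear and quadratic in
    \<open>forced_coeff x1\<close>.\<close>
  have A: "A1 - A2 = m * c1" "A1 - 2 * A2 + A3 = 2 * m\<^sup>2 * c2"
    unfolding A1_def A2_def A3_def c1_def c2_def using nz
    by (intro partial_fractions_1 partial_fractions_3; simp)+
  have Mm: "forced_coeff x1 * m = \<alpha> * x1\<^sup>2" using forced_coeff_mult[of x1] unfolding m_def .
  have "h4_prim x1 x2 0 = - 2 * \<alpha> * ((x2 + forced_coeff x1)\<^sup>2 * A1 - 2 * (x2 + forced_coeff x1) * forced_coeff x1 * A2 + (forced_coeff x1)\<^sup>2 * A3)"
    unfolding h4_prim_def mult_zero_right exp_zero unfolding eqs A1_def A2_def A3_def by simp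
  also have "\<dots> = - (2 * \<alpha>) * A1 * x2^2 + - (4 * \<alpha>^2) * c1 * x1^2 * x2 + - (4 * \<alpha>^3) * c2 * x1^4"
    using A Mm by algebra
  finally show ?thesis
    unfolding eqs A1_def c1_def c2_def by simp
qed

text \<open>Duhamel's formula with the integral already evaluated: subtracting the primitive at
  \<open>- \<tau>\<close> encodes the zero initial value. At s = 0 the exponential factors are 1, so
  \<tau> enters only through a primitive that vanishes at minus infinity.\<close>

definition ys_sol :: "real \<Rightarrow> real \<Rightarrow> real \<Rightarrow> real \<Rightarrow> ltwo" where
  "ys_sol x1 x2 \<tau> s = (exp (\<beta> 3 * s) * (h3_prim x1 x2 s - h3_prim x1 x2 (- \<tau>))) *\<^sub>R e 3
     + (exp (\<beta> 4 * s) * (h4_prim x1 x2 s - h4_prim x1 x2 (- \<tau>))) *\<^sub>R e 4"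

lemma ys_sol_deriv: "(ys_sol x1 x2 \<tau> has_vector_derivative
    Ls \<nu> lam l (ys_sol x1 x2 \<tau> s) + Ps l (Bop \<gamma> l (yc2_sol x1 x2 s) (yc2_sol x1 x2 s))) (at s)"
proof -
  have "(ys_sol x1 x2 \<tau> has_vector_derivative
     (\<beta> 3 * (exp (\<beta> 3 * s) * (h3_prim x1 x2 s - h3_prim x1 x2 (- \<tau>))) + exp (\<beta> 3 * s) * h3_integrand x1 x2 s) *\<^sub>R e 3
     + (\<beta> 4 * (exp (\<beta> 4 * s) * (h4_prim x1 x2 s - h4_prim x1 x2 (- \<tau>))) + exp (\<beta> 4 * s) * h4_integrand x1 x2 s) *\<^sub>R e 4) (at s)"
    unfolding ys_sol_def[abs_def]
    by (rule has_vector_derivative_pair) (auto intro!: derivative_eq_intros h3_prim_deriv h4_prim_deriv)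
  moreover have "exp (\<beta> 3 * s) * h3_integrand x1 x2 s = - 3 * \<alpha> * yc2_coeff1 x1 x2 s * yc2_coeff2 x1 x2 s"
    "exp (\<beta> 4 * s) * h4_integrand x1 x2 s = - 2 * \<alpha> * (yc2_coeff2 x1 x2 s)\<^sup>2"
    unfolding h3_integrand_def h4_integrand_def mult.assoc[symmetric] by (simp_all flip: exp_add)
  ultimately show ?thesis
    unfolding yc2_sol_def Ps_Bop unfolding ys_sol_def Ls_pair by (simp add: algebra_simps)
qed

lemma ys2_eq:
  assumes \<tau>: "\<tau> > 0"
  shows "ys2 \<nu> lam \<gamma> l (x1 *\<^sub>R e 1 + x2 *\<^sub>R e 2) \<tau> 0 = ys_sol x1 x2 \<tau> 0"
  unfolding ys2_def
proof (rule the_equality)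
  have "two_layer_system \<nu> lam \<gamma> l \<tau> (x1 *\<^sub>R e 1 + x2 *\<^sub>R e 2) (yc1_sol x1 x2) (yc2_sol x1 x2) (ys_sol x1 x2 \<tau>)"
    unfolding two_layer_system_def
  proof (intro conjI ballI backward_layers_Y has_vector_derivative_at_within[OF ys_sol_deriv])
    show "ys_sol x1 x2 \<tau> s \<in> Ldom l \<inter> Hs l" for s
      unfolding ys_sol_def by (rule stable_pair_mem)
  qed (simp add: ys_sol_def)
  then show "\<exists>y1 y2 ys. two_layer_system \<nu> lam \<gamma> l \<tau> (x1 *\<^sub>R e 1 + x2 *\<^sub>R e 2) y1 y2 ys \<and> ys_sol x1 x2 \<tau> 0 = ys 0"
    by blast
  fix v assume "\<exists>y1 y2 ys. two_layer_system \<nu> lam \<gamma> l \<tau> (x1 *\<^sub>R e 1 + x2 *\<^sub>R e 2) y1 y2 ys \<and> v = ys 0"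
  then obtain y1 y2 ys where sys: "two_layer_system \<nu> lam \<gamma> l \<tau> (x1 *\<^sub>R e 1 + x2 *\<^sub>R e 2) y1 y2 ys" and v: "v = ys 0"
    by blast
  \<comment> \<open>The competitor brings its own backward layers. Identifying them on the whole
    interval gives both stable components the same forcing.\<close>
  have y2: "y2 t = yc2_sol x1 x2 t" if "t \<in> {-\<tau>..0}" for t
    using sys that unfolding two_layer_system_def
    by (intro backward_layers_unique(2)[of x1 x2 "{-\<tau>..0}" y1]) auto
  have ys: "ys t \<in> Ldom l \<inter> Hs l \<and> (ys has_vector_derivative
      Ls \<nu> lam l (ys t) + Ps l (Bop \<gamma> l (yc2_sol x1 x2 t) (yc2_sol x1 x2 t))) (at t within {-\<tau>..0})"
    if "t \<in> {-\<tau>..0}" for t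
    using sys that unfolding two_layer_system_def y2[OF that, symmetric] by auto
  have "ys 0 = ys_sol x1 x2 \<tau> 0"
  proof (rule stable_unique[where a="-\<tau>" and b=0 and y=ys and z="ys_sol x1 x2 \<tau>" and g="\<lambda>t. Ps l (Bop \<gamma> l (yc2_sol x1 x2 t) (yc2_sol x1 x2 t))"])
    show "continuous_on {-\<tau>..0} ys" "continuous_on {-\<tau>..0} (ys_sol x1 x2 \<tau>)"
      by (rule continuous_on_vector_derivative, erule conjunct2[OF ys])
        (rule continuous_on_vector_derivative, rule has_vector_derivative_at_within[OF ys_sol_deriv])
    fix t assume t: "-\<tau> < t" "t < 0"
    then show "ys t \<in> Ldom l \<inter> Hs l \<and> (ys has_vector_derivative
        Ls \<nu> lam l (ys t) + Ps l (Bop \<gamma> l (yc2_sol x1 x2 t) (yc2_sol x1 x2 t))) (at t)"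
      using ys[of t] by (simp add: at_within_Icc_at)
    show "ys_sol x1 x2 \<tau> t \<in> Ldom l \<inter> Hs l \<and> (ys_sol x1 x2 \<tau> has_vector_derivative
        Ls \<nu> lam l (ys_sol x1 x2 \<tau> t) + Ps l (Bop \<gamma> l (yc2_sol x1 x2 t) (yc2_sol x1 x2 t))) (at t)"
      using ys_sol_deriv stable_pair_mem unfolding ys_sol_def by auto
  next
    show "ys (-\<tau>) = ys_sol x1 x2 \<tau> (-\<tau>)"
      using sys by (simp add: two_layer_system_def ys_sol_def)
  qed (use \<tau> in simp)
  then show "v = ys_sol x1 x2 \<tau> 0" using v by simp
qed

lemma ys2_tendsto:
  "((\<lambda>\<tau>. ys2 \<nu> lam \<gamma> l (x1 *\<^sub>R e 1 + x2 *\<^sub>R e 2) \<tau> 0) \<longlongrightarrow> h3_prim x1 x2 0 *\<^sub>R e 3 + h4_prim x1 x2 0 *\<^sub>R e 4) at_top"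
proof -
  have "((\<lambda>\<tau>. (h3_prim x1 x2 0 - h3_prim x1 x2 (- \<tau>)) *\<^sub>R e 3 + (h4_prim x1 x2 0 - h4_prim x1 x2 (- \<tau>)) *\<^sub>R e 4)
      \<longlongrightarrow> (h3_prim x1 x2 0 - 0) *\<^sub>R e 3 + (h4_prim x1 x2 0 - 0) *\<^sub>R e 4) at_top"
    by (intro tendsto_intros filterlim_compose[OF h3_prim_at_bot filterlim_uminus_at_bot_at_top]
        filterlim_compose[OF h4_prim_at_bot filterlim_uminus_at_bot_at_top])
  then have "((\<lambda>\<tau>. (h3_prim x1 x2 0 - h3_prim x1 x2 (- \<tau>)) *\<^sub>R e 3 + (h4_prim x1 x2 0 - h4_prim x1 x2 (- \<tau>)) *\<^sub>R e 4)
      \<longlongrightarrow> h3_prim x1 x2 0 *\<^sub>R e 3 + h4_prim x1 x2 0 *\<^sub>R e 4) at_top" by simp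
  then show ?thesis
  proof (rule Lim_transform_eventually)
    \<comment> \<open>The closed form of \<open>ys2\<close> is available for positive \<tau>, hence
      only eventually.\<close>
    show "\<forall>\<^sub>F \<tau> in at_top. (h3_prim x1 x2 0 - h3_prim x1 x2 (- \<tau>)) *\<^sub>R e 3 + (h4_prim x1 x2 0 - h4_prim x1 x2 (- \<tau>)) *\<^sub>R e 4
        = ys2 \<nu> lam \<gamma> l (x1 *\<^sub>R e 1 + x2 *\<^sub>R e 2) \<tau> 0"
      using eventually_gt_at_top[of "0::real"]
      by eventually_elim (simp add: ys2_eq[simplified] ys_sol_def)
  qed
qed

lemma pullback_h2_eq:
  "pullback_h2 \<nu> lam \<gamma> l (x1 *\<^sub>R e 1 + x2 *\<^sub>R e 2) = h3_prim x1 x2 0 *\<^sub>R e 3 + h4_prim x1 x2 0 *\<^sub>R e 4"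
  unfolding pullback_h2_def by (intro tendsto_Lim ys2_tendsto) simp

section \<open>The integral representation\<close>

lemma pullback_integrand_eq:
  assumes "t \<le> 0"
  shows "pullback_integrand \<nu> lam \<gamma> l (x1 *\<^sub>R e 1 + x2 *\<^sub>R e 2) t = h3_integrand x1 x2 t *\<^sub>R e 3 + h4_integrand x1 x2 t *\<^sub>R e 4"
proof -
  have "- t \<ge> 0" using assms by simp
  show ?thesis
    unfolding pullback_integrand_def yc2_eq[OF assms] yc2_sol_def Ps_Bop exp_Ls_pair[OF \<open>- t \<ge> 0\<close>] h3_integrand_def h4_integrand_def
    by (simp add: mult.commute)
qed

lemma integrand_has_integral:
  "(pullback_integrand \<nu> lam \<gamma> l (x1 *\<^sub>R e 1 + x2 *\<^sub>R e 2) has_integral h3_prim x1 x2 0 *\<^sub>R e 3 + h4_prim x1 x2 0 *\<^sub>R e 4) {..0}"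
proof -
  have "(h3_integrand x1 x2 has_integral h3_prim x1 x2 0 - 0) {..0}" "(h4_integrand x1 x2 has_integral h4_prim x1 x2 0 - 0) {..0}"
    by (intro has_integral_FTC_at_bot h3_prim_deriv h4_prim_deriv continuous_h3_integrand continuous_h4_integrand
        integrable_h3_integrand integrable_h4_integrand h3_prim_at_bot h4_prim_at_bot)+
  then have "((\<lambda>t. h3_integrand x1 x2 t *\<^sub>R e 3 + h4_integrand x1 x2 t *\<^sub>R e 4) has_integral h3_prim x1 x2 0 *\<^sub>R e 3 + h4_prim x1 x2 0 *\<^sub>R e 4) {..0}"
    by (intro has_integral_add has_integral_scaleR_left) simp_all
  then show ?thesis
    by (rule has_integral_eq[rotated]) (simp only: pullback_integrand_eq atMost_iff)
qed

text \<open>By orthonormality the norm is the Euclidean length of the two coordinates, hence at most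
  the sum of their absolute values, which are integrable on the half-line.\<close>

lemma norm_integrand_integrable:
  "(\<lambda>t. norm (pullback_integrand \<nu> lam \<gamma> l (x1 *\<^sub>R e 1 + x2 *\<^sub>R e 2) t)) integrable_on {..0}"
proof -
  let ?n = "\<lambda>t. sqrt ((h3_integrand x1 x2 t)\<^sup>2 + (h4_integrand x1 x2 t)\<^sup>2)"
  have eq: "norm (pullback_integrand \<nu> lam \<gamma> l (x1 *\<^sub>R e 1 + x2 *\<^sub>R e 2) t) = ?n t" if "t \<le> 0" for t
    unfolding pullback_integrand_eq[OF that]
    using orthonormal_pair_norm[OF l, of 3 4 "h3_integrand x1 x2 t" "h4_integrand x1 x2 t"] by (intro real_sqrt_unique[symmetric]) auto
  have "set_integrable lborel {..<0} ?n"
    unfolding set_integrable_def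
  proof (rule Bochner_Integration.integrable_bound)
    show "integrable lborel (\<lambda>t. \<bar>indicator {..<0} t *\<^sub>R h3_integrand x1 x2 t\<bar> + \<bar>indicator {..<0} t *\<^sub>R h4_integrand x1 x2 t\<bar>)"
      using integrable_h3_integrand integrable_h4_integrand unfolding set_integrable_def
      by (intro Bochner_Integration.integrable_add integrable_abs)
    have "continuous_on UNIV ?n" by (intro continuous_intros continuous_h3_integrand continuous_h4_integrand)
    then have [measurable]: "?n \<in> borel_measurable borel" by (rule borel_measurable_continuous_onI)
    show "(\<lambda>t. indicat_real {..<0} t *\<^sub>R ?n t) \<in> borel_measurable lborel" by measurable
    show "AE t in lborel. norm (indicat_real {..<0} t *\<^sub>R ?n t)
        \<le> norm (\<bar>indicat_real {..<0} t *\<^sub>R h3_integrand x1 x2 t\<bar> + \<bar>indicat_real {..<0} t *\<^sub>R h4_integrand x1 x2 t\<bar>)"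
      by (auto simp: indicator_def intro: sqrt_sum_squares_le_sum_abs)
  qed
  then have "?n integrable_on {..<0}" by (rule set_borel_integral_eq_integral)
  then have "?n integrable_on {..0}"
    by (rule integrable_spike_set_eq[THEN iffD1, rotated]) (rule negligible_subset[of "{0}"]; auto)
  then show ?thesis
    by (rule integrable_eq) (simp add: eq[simplified])
qed

end

theorem theorem6p1:
  fixes \<nu> lam \<gamma> l :: real and \<beta> :: "nat \<Rightarrow> real"
    and \<alpha> cA cB cC cD cE cF cG :: real
  defines "\<beta> \<equiv> eigval \<nu> lam l"
    and "\<alpha> \<equiv> \<gamma> * pi / (sqrt 2 * l powr (3 / 2))"
    and "cA \<equiv> - (3 * \<alpha>) / (\<beta> 1 + \<beta> 2 - \<beta> 3)"
    and "cB \<equiv> - (3 * \<alpha>^2) / ((3 * \<beta> 1 - \<beta> 3) * (\<beta> 1 + \<beta> 2 - \<beta> 3))"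
    and "cC \<equiv> 3 * \<alpha>^2 / ((\<beta> 1 + 2 * \<beta> 2 - \<beta> 3) * (\<beta> 1 + \<beta> 2 - \<beta> 3))"
    and "cD \<equiv> 3 * \<alpha>^3 / ((3 * \<beta> 1 - \<beta> 3) * (\<beta> 1 + \<beta> 2 - \<beta> 3) * (\<beta> 1 + 2 * \<beta> 2 - \<beta> 3))
            + 3 * \<alpha>^3 / ((3 * \<beta> 1 - \<beta> 3) * (3 * \<beta> 1 + \<beta> 2 - \<beta> 3) * (\<beta> 1 + 2 * \<beta> 2 - \<beta> 3))"
    and "cE \<equiv> - (2 * \<alpha>) / (2 * \<beta> 2 - \<beta> 4)"
    and "cF \<equiv> - (4 * \<alpha>^2) / ((2 * \<beta> 1 + \<beta> 2 - \<beta> 4) * (2 * \<beta> 2 - \<beta> 4))"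
    and "cG \<equiv> - (4 * \<alpha>^3) / ((4 * \<beta> 1 - \<beta> 4) * (2 * \<beta> 1 + \<beta> 2 - \<beta> 4) * (2 * \<beta> 2 - \<beta> 4))"
  assumes "\<nu> > 0" "lam > 0" "\<gamma> > 0" "l > 0"
    and "\<beta> 1 + \<beta> 2 - \<beta> 3 > 0" "\<beta> 1 + 2 * \<beta> 2 - \<beta> 3 > 0"
        "3 * \<beta> 1 - \<beta> 3 > 0" "3 * \<beta> 1 + \<beta> 2 - \<beta> 3 > 0"
    and "2 * \<beta> 1 + \<beta> 2 - \<beta> 4 > 0" "4 * \<beta> 1 - \<beta> 4 > 0" "2 * \<beta> 2 - \<beta> 4 > 0"
  shows "(\<forall>\<xi> \<in> Hc l.
           ((\<lambda>\<tau>. ys2 \<nu> lam \<gamma> l \<xi> \<tau> 0) \<longlongrightarrow> pullback_h2 \<nu> lam \<gamma> l \<xi>) at_top \<and>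
           (\<lambda>t. norm (pullback_integrand \<nu> lam \<gamma> l \<xi> t)) integrable_on {..0} \<and>
           (pullback_integrand \<nu> lam \<gamma> l \<xi> has_integral pullback_h2 \<nu> lam \<gamma> l \<xi>) {..0}) \<and>
         (\<forall>\<xi>1 \<xi>2 :: real.
           pullback_h2 \<nu> lam \<gamma> l (\<xi>1 *\<^sub>R eigvec l 1 + \<xi>2 *\<^sub>R eigvec l 2) =
             (cA * \<xi>1 * \<xi>2 + cB * \<xi>1^3 + cC * \<xi>1 * \<xi>2^2 + cD * \<xi>1^3 * \<xi>2) *\<^sub>R eigvec l 3 +
             (cE * \<xi>2^2 + cF * \<xi>1^2 * \<xi>2 + cG * \<xi>1^4) *\<^sub>R eigvec l 4)"
proof -
  interpret B: burgers \<nu> lam \<gamma> l by unfold_locales fact+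
  show ?thesis
  proof (intro conjI ballI allI)
    fix \<xi> assume "\<xi> \<in> Hc l"
    then obtain x1 x2 where \<xi>: "\<xi> = x1 *\<^sub>R eigvec l 1 + x2 *\<^sub>R eigvec l 2" by (rule Hc_cases)
    show "((\<lambda>\<tau>. ys2 \<nu> lam \<gamma> l \<xi> \<tau> 0) \<longlongrightarrow> pullback_h2 \<nu> lam \<gamma> l \<xi>) at_top"
      unfolding \<xi> B.pullback_h2_eq by (rule B.ys2_tendsto)
    show "(\<lambda>t. norm (pullback_integrand \<nu> lam \<gamma> l \<xi> t)) integrable_on {..0}"
      unfolding \<xi> by (rule B.norm_integrand_integrable)
    show "(pullback_integrand \<nu> lam \<gamma> l \<xi> has_integral pullback_h2 \<nu> lam \<gamma> l \<xi>) {..0}"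
      unfolding \<xi> B.pullback_h2_eq by (rule B.integrand_has_integral)
  next
    fix \<xi>1 \<xi>2 :: real
    show "pullback_h2 \<nu> lam \<gamma> l (\<xi>1 *\<^sub>R eigvec l 1 + \<xi>2 *\<^sub>R eigvec l 2) =
             (cA * \<xi>1 * \<xi>2 + cB * \<xi>1^3 + cC * \<xi>1 * \<xi>2^2 + cD * \<xi>1^3 * \<xi>2) *\<^sub>R eigvec l 3 +
             (cE * \<xi>2^2 + cF * \<xi>1^2 * \<xi>2 + cG * \<xi>1^4) *\<^sub>R eigvec l 4"
      unfolding B.pullback_h2_eq B.h3_prim_0 B.h4_prim_0 B.\<alpha>_def
      unfolding cA_def cB_def cC_def cD_def cE_def cF_def cG_def \<alpha>_def \<beta>_def ..
  qed
qed

end
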